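(* Suppose the sampling and moment assumptions stated in the context hold. Then $$\sup_{x\in\mathcal X}\Bigg[\frac1n\sum_{i=1}^n\Big\{\frac1{n-1}\sum_{j\ne i}d_{x,A_n(x),\widehat\beta}(Z_{ij})-\mathbb P_nd_{x,A_n(x),\widehat\beta}\Big\}^2\Bigg]^{1/2}=o_p(1).$$
   Context: Sampling assumption: node variables $(U_i)_{i\ge1}$ are i.i.d., dyad variables $(U_{ij})_{i<j}$ are i.i.d., and all are mutually independent. For $i<j$, $Z_{ij}=(Y_{ij},X_{ij}')'=\tau(U_i,U_j,U_{ij})$ with $\tau$ measurable and symmetric in its first two arguments, $Y_{ij}\in\mathbb R$, $X_{ij}\in\mathcal X\subset\mathbb R^d$, $\mathcal X$ a compact rectangle; $Z_{ij}=Z_{ji}$ for $j<i$. One observes $Z_{ij}$ for $1\le i<j\le n$. $N_n=n(n-1)/2$, $\mathbb P_nf=N_n^{-1}\sum_{i<j}f(Z_{ij})$. Moment assumption: $\|X_{12}\|\le C_X<\infty$ a.s.; $E|Y_{12}|^{4+\delta}<\infty$ for some $\delta>0$; $Q=E[X_{12}X_{12}']$ has smallest eigenvalue bounded away from zero. Objects ($\preceq$ is coordinatewise inequality): $\beta_*=Q^{-1}E[X_{12}Y_{12}]$, $M(x)=E[X_{12}\mathbf 1\{X_{12}\preceq x\}]$, $r_x(y,z)=(y-z'\beta_* )\{\mathbf 1(z\preceq x)-M(x)'Q^{-1}z\}$, $d_{x,a,b}(y,z)=(y-z'b)\{\mathbf 1(z\preceq x)-a'z\}-r_x(y,z)$.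 Estimated objects (arbitrary if $Q_n$ is singular): $Q_n=\mathbb P_n(XX')$, $\widehat\beta=Q_n^{-1}\mathbb P_n(XY)$, $M_n(x)=\mathbb P_n[X\mathbf 1\{X\preceq x\}]$, $A_n(x)=Q_n^{-1}M_n(x)$. *)

theory Defs
  imports "HOL-Probability.Probability"
begin

section \<open>Dyadic sampling\<close>

text \<open>Nodes are numbered from 1. Mutual independence of the node variables \<open>U i\<close> and the dyad
  variables \<open>V i j\<close>, which may take values in different spaces, is independence of the family of
  events they generate, indexed by a sum type.\<close>

definition dyad_indices :: "(nat \<times> nat) set" where
  "dyad_indices = {(i, j). 1 \<le> i \<and> i < j}"

definition preimages :: "'w measure \<Rightarrow> 'a measure \<Rightarrow> ('w \<Rightarrow> 'a) \<Rightarrow> 'w set set" where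
  "preimages M N f = {f -` A \<inter> space M | A. A \<in> sets N}"

definition dyadic_sampling ::
  "'w measure \<Rightarrow> 'u measure \<Rightarrow> 'v measure \<Rightarrow> (nat \<Rightarrow> 'w \<Rightarrow> 'u) \<Rightarrow> (nat \<Rightarrow> nat \<Rightarrow> 'w \<Rightarrow> 'v) \<Rightarrow> bool"
where
  "dyadic_sampling M NU NV U V \<longleftrightarrow>
     prob_space M \<and>
     (\<forall>i\<ge>1. U i \<in> measurable M NU) \<and>
     (\<forall>(i, j)\<in>dyad_indices. V i j \<in> measurable M NV) \<and>
     (\<forall>i\<ge>1. distr M NU (U i) = distr M NU (U 1)) \<and>
     (\<forall>(i, j)\<in>dyad_indices. distr M NV (V i j) = distr M NV (V 1 2)) \<and>
     prob_space.indep_sets M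
       (case_sum (\<lambda>i. preimages M NU (U i)) (\<lambda>(i, j). preimages M NV (V i j)))
       (Inl ` {1..} \<union> Inr ` dyad_indices)"

text \<open>The observation on a dyad is extended by \<open>Z j i = Z i j\<close>; the diagonal is never used.\<close>

definition dyad_obs ::
  "('u \<times> 'u \<times> 'v \<Rightarrow> 'z) \<Rightarrow> (nat \<Rightarrow> 'w \<Rightarrow> 'u) \<Rightarrow> (nat \<Rightarrow> nat \<Rightarrow> 'w \<Rightarrow> 'v) \<Rightarrow> 'w \<Rightarrow> nat \<Rightarrow> nat \<Rightarrow> 'z"
where
  "dyad_obs \<tau> U V \<omega> i j =
     (if i < j then \<tau> (U i \<omega>, U j \<omega>, V i j \<omega>) else \<tau> (U j \<omega>, U i \<omega>, V j i \<omega>))"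

definition dyad_mean :: "nat \<Rightarrow> (nat \<Rightarrow> nat \<Rightarrow> 'z) \<Rightarrow> ('z \<Rightarrow> 'b::real_vector) \<Rightarrow> 'b" where
  "dyad_mean n z f =
     (\<Sum>(i, j)\<in>{(i, j). 1 \<le> i \<and> i < j \<and> j \<le> n}. f (z i j)) /\<^sub>R (real n * (real n - 1) / 2)"

section \<open>Population and sample regression objects\<close>

text \<open>Observations are pairs \<open>(y, x)\<close> of outcome and regressor. The order on \<open>real ^ 'd\<close> is the
  coordinatewise one.\<close>

definition outer :: "real ^ 'd \<Rightarrow> real ^ 'd ^ 'd" where
  "outer x = (\<chi> i j. x $ i * x $ j)"

definition eigenvalue :: "real ^ 'd ^ 'd \<Rightarrow> real \<Rightarrow> bool" where
  "eigenvalue A k \<longleftrightarrow> (\<exists>v. v \<noteq> 0 \<and> A *v v = k *\<^sub>R v)"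

definition pop_Q :: "'w measure \<Rightarrow> ('w \<Rightarrow> real \<times> (real ^ 'd)) \<Rightarrow> real ^ 'd ^ 'd" where
  "pop_Q M Z = (\<integral>\<omega>. outer (snd (Z \<omega>)) \<partial>M)"

definition pop_beta :: "'w measure \<Rightarrow> ('w \<Rightarrow> real \<times> (real ^ 'd)) \<Rightarrow> real ^ 'd" where
  "pop_beta M Z = matrix_inv (pop_Q M Z) *v (\<integral>\<omega>. fst (Z \<omega>) *\<^sub>R snd (Z \<omega>) \<partial>M)"

definition pop_M :: "'w measure \<Rightarrow> ('w \<Rightarrow> real \<times> (real ^ 'd)) \<Rightarrow> real ^ 'd \<Rightarrow> real ^ 'd" where
  "pop_M M Z x = (\<integral>\<omega>. of_bool (snd (Z \<omega>) \<le> x) *\<^sub>R snd (Z \<omega>) \<partial>M)"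

definition r_fun ::
  "'w measure \<Rightarrow> ('w \<Rightarrow> real \<times> (real ^ 'd)) \<Rightarrow> real ^ 'd \<Rightarrow> real \<times> (real ^ 'd) \<Rightarrow> real"
where
  "r_fun M Z x = (\<lambda>(y, z). (y - z \<bullet> pop_beta M Z) *
     (of_bool (z \<le> x) - pop_M M Z x \<bullet> (matrix_inv (pop_Q M Z) *v z)))"

definition d_fun ::
  "'w measure \<Rightarrow> ('w \<Rightarrow> real \<times> (real ^ 'd)) \<Rightarrow> real ^ 'd \<Rightarrow> real ^ 'd \<Rightarrow> real ^ 'd \<Rightarrow>
     real \<times> (real ^ 'd) \<Rightarrow> real"
where
  "d_fun M Z x a b = (\<lambda>(y, z). (y - z \<bullet> b) * (of_bool (z \<le> x) - a \<bullet> z) - r_fun M Z x (y, z))"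

definition sample_Q :: "nat \<Rightarrow> (nat \<Rightarrow> nat \<Rightarrow> real \<times> (real ^ 'd)) \<Rightarrow> real ^ 'd ^ 'd" where
  "sample_Q n z = dyad_mean n z (\<lambda>(y, x). outer x)"

definition sample_XY :: "nat \<Rightarrow> (nat \<Rightarrow> nat \<Rightarrow> real \<times> (real ^ 'd)) \<Rightarrow> real ^ 'd" where
  "sample_XY n z = dyad_mean n z (\<lambda>(y, x). y *\<^sub>R x)"

definition sample_M :: "nat \<Rightarrow> (nat \<Rightarrow> nat \<Rightarrow> real \<times> (real ^ 'd)) \<Rightarrow> real ^ 'd \<Rightarrow> real ^ 'd" where
  "sample_M n z x = dyad_mean n z (\<lambda>(_, x'). of_bool (x' \<le> x) *\<^sub>R x')"

definition node_deviation :: "nat \<Rightarrow> (nat \<Rightarrow> nat \<Rightarrow> 'z) \<Rightarrow> ('z \<Rightarrow> real) \<Rightarrow> real" where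
  "node_deviation n z f = sqrt (1 / real n * (\<Sum>i\<in>{1..n}.
     (1 / (real n - 1) * (\<Sum>j\<in>{1..n} - {i}. f (z i j)) - dyad_mean n z f)\<^sup>2))"

section \<open>Convergence in probability to zero\<close>

text \<open>Outer probability is used because the random variables below need not be measurable: they
  are suprema over an uncountable set, and the estimators are arbitrary functions on the event that
  the sample second moment matrix is singular. Such a supremum may also be infinite.\<close>

definition small_o_p_one :: "'w measure \<Rightarrow> (nat \<Rightarrow> 'w \<Rightarrow> ereal) \<Rightarrow> bool" where
  "small_o_p_one M T \<longleftrightarrow> (\<forall>\<epsilon>::real. \<epsilon> > 0 \<longrightarrow>
     (\<lambda>n. outer_measure_of M {\<omega> \<in> space M. \<bar>T n \<omega>\<bar> > ereal \<epsilon>}) \<longlonglongrightarrow> 0)"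

end

theory Submission
  imports Defs "HOL-Real_Asymp.Real_Asymp"
begin

text \<open>The node deviation of \<open>d\<close> is a standard deviation of row means, hence at most the square root of
  the dyadic mean of \<open>d\<^sup>2\<close>. Writing \<open>e\<close> and \<open>\<alpha>\<close> for the estimation errors of \<open>\<beta>hat\<close> and
  of \<open>A n x\<close>, one has \<open>d (y, z) = - (z \<bullet> e) (1(z \<le> x) - A n x \<bullet> z) - (y - z \<bullet> \<beta>) (\<alpha> \<bullet> z)\<close>, which on
  the bounded regressor space is at most a constant times \<open>max |e| |\<alpha>| (1 + |y|)\<close>. It remains that
  \<open>e\<close> and \<open>\<alpha>\<close>, the latter uniformly in \<open>x\<close>, vanish in probability and that the dyadic mean
  of \<open>y\<^sup>2\<close> stays bounded. Both follow from a law of large numbers for dyadic means, obtained from a variance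
  bound, from perturbation of the defining linear systems, and from a bracketing argument for the
  orthant indicators.\<close>

section \<open>Dyadic means and linear systems\<close>

text \<open>The bound on \<open>d\<close> has the same constant for every \<open>x\<close>, so
  uniformity in \<open>x\<close> has to be earned only for \<open>sample_M\<close>. In
  \<open>d\<close> the indicator is the same in both products and cancels from the coefficient of
  \<open>y - z \<bullet> \<beta>\<close>, which leaves just the two estimation errors. Dyads with a
  common node are dependent, but they make up only order n^3 of the order n^4 pairs of dyads, so
  dyadic means still have variance of order 1/n. This variance bound is also applied to y^2, which
  is where a fourth moment of y enters. The estimators are arbitrary where \<open>sample_Q\<close>
  is singular. All estimates are therefore made pointwise, outside a measurable event of small
  probability.\<close>

lemma sum_off_diagonal:
  fixes g :: "nat \<Rightarrow> nat \<Rightarrow> real"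
  assumes sym: "\<And>i j. i \<noteq> j \<Longrightarrow> g i j = g j i"
  shows "(\<Sum>i\<in>{1..n}. \<Sum>j\<in>{1..n} - {i}. g i j) = 2 * (\<Sum>(i, j)\<in>{(i, j). 1 \<le> i \<and> i < j \<and> j \<le> n}. g i j)"
proof -
  let ?D = "{(i, j). 1 \<le> i \<and> i < j \<and> j \<le> n}" and ?D' = "{(j, i). 1 \<le> i \<and> i < j \<and> j \<le> n}"
  have fin: "finite ?D" "finite ?D'"
    by (auto intro: finite_subset[of _ "{1..n} \<times> {1..n}"])
  have "(\<Sum>i\<in>{1..n}. \<Sum>j\<in>{1..n} - {i}. g i j) = (\<Sum>(i, j)\<in>(SIGMA i:{1..n}. {1..n} - {i}). g i j)"
    by (rule sum.Sigma) auto
  also have "(SIGMA i:{1..n}. {1..n} - {i}) = ?D \<union> ?D'"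
    by (auto simp: not_less)
  also have "(\<Sum>(i, j)\<in>?D \<union> ?D'. g i j) = (\<Sum>(i, j)\<in>?D. g i j) + (\<Sum>(i, j)\<in>?D'. g i j)"
    by (rule sum.union_disjoint) (use fin in auto)
  also have "(\<Sum>(i, j)\<in>?D'. g i j) = (\<Sum>(i, j)\<in>?D. g i j)"
    by (rule sum.reindex_bij_witness[where i = prod.swap and j = prod.swap]) (auto simp: sym)
  finally show ?thesis by simp
qed

lemma finite_dyads: "finite {(i, j). 1 \<le> i \<and> i < j \<and> j \<le> (n::nat)}"
  by (auto intro: finite_subset[of _ "{1..n} \<times> {1..n}"])

lemma card_dyads: "real (card {(i, j). 1 \<le> i \<and> i < j \<and> j \<le> n}) = real n * (real n - 1) / 2"
  using sum_off_diagonal[of "\<lambda>_ _. 1" n] by (cases n) auto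

text \<open>For \<open>n < 2\<close> there is no dyad and the mean is 0, whence the
  restriction.\<close>

lemma dyad_mean_const: "2 \<le> n \<Longrightarrow> dyad_mean n z (\<lambda>_. m) = m"
  unfolding dyad_mean_def case_prod_unfold sum_constant_scaleR card_dyads[unfolded case_prod_unfold]
  by simp

lemma dyad_mean_add: "dyad_mean n z (\<lambda>x. f x + g x) = dyad_mean n z f + dyad_mean n z g"
  unfolding dyad_mean_def case_prod_unfold sum.distrib scaleR_right_distrib ..

lemma dyad_mean_mult: "dyad_mean n z (\<lambda>x. c * f x) = c * dyad_mean n z f" for c :: real
  unfolding dyad_mean_def case_prod_unfold sum_distrib_left[symmetric] real_scaleR_def
  by (rule mult.left_commute)

text \<open>At \<open>n = 0\<close> the factor \<open>real n - 1\<close> is -1, but it is multiplied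
  by 0.\<close>

lemma dyad_mean_weight_nonneg: "0 \<le> real n * (real n - 1) / 2"
  by (cases n) auto

lemma dyad_mean_mono:
  fixes f g :: "'z \<Rightarrow> real"
  assumes "\<And>i j. 1 \<le> i \<Longrightarrow> i < j \<Longrightarrow> f (z i j) \<le> g (z i j)"
  shows "dyad_mean n z f \<le> dyad_mean n z g"
  unfolding dyad_mean_def real_scaleR_def
  by (intro mult_left_mono sum_mono) (use assms dyad_mean_weight_nonneg[of n] in auto)

text \<open>The bound is required at the observed values only, because the bounds supplied later
  hold just for regressors in the box.\<close>

lemma norm_dyad_mean_diff_le:
  assumes "\<And>i j. 1 \<le> i \<Longrightarrow> i < j \<Longrightarrow> norm (f (z i j) - g (z i j)) \<le> h (z i j)"
  shows "norm (dyad_mean n z f - dyad_mean n z g) \<le> dyad_mean n z h"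
proof -
  let ?D = "{(i, j). 1 \<le> i \<and> i < j \<and> j \<le> n}"
  have "norm (dyad_mean n z f - dyad_mean n z g) =
      norm (\<Sum>(i, j)\<in>?D. f (z i j) - g (z i j)) / (real n * (real n - 1) / 2)"
    unfolding dyad_mean_def scaleR_diff_right[symmetric] using dyad_mean_weight_nonneg[of n]
    by (simp add: case_prod_unfold sum_subtractf divide_simps split: if_splits)
  also have "\<dots> \<le> (\<Sum>(i, j)\<in>?D. h (z i j)) / (real n * (real n - 1) / 2)"
    by (intro divide_right_mono dyad_mean_weight_nonneg sum_norm_le[THEN order_trans] order_refl)
      (use assms in auto)
  finally show ?thesis
    by (simp only: dyad_mean_def real_scaleR_def divide_inverse mult.commute)
qed

lemma dyad_mean_inner: "dyad_mean n z f \<bullet> b = dyad_mean n z (\<lambda>x. f x \<bullet> b)"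
  by (simp add: dyad_mean_def inner_sum_left case_prod_unfold)

text \<open>A variance is at most the second moment, and Jensen's inequality applies to every row.\<close>

lemma node_deviation_le:
  fixes f :: "'z \<Rightarrow> real"
  assumes sym: "\<And>i j. i \<noteq> j \<Longrightarrow> z i j = z j i" and n: "2 \<le> n"
  shows "node_deviation n z f \<le> sqrt (dyad_mean n z (\<lambda>x. (f x)\<^sup>2))"
proof -
  define R where "R i = 1 / (real n - 1) * (\<Sum>j\<in>{1..n} - {i}. f (z i j))" for i
  define m where "m = dyad_mean n z f"
  \<comment> \<open>Summing over rows visits every dyad twice, and n (n - 1) is twice the number of
    dyads. This is used for \<open>f\<close> and for its square.\<close>
  have mean: "(\<Sum>i\<in>{1..n}. 1 / (real n - 1) * (\<Sum>j\<in>{1..n} - {i}. g (z i j))) = real n * dyad_mean n z g"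
    for g :: "'z \<Rightarrow> real"
    unfolding sum_distrib_left[symmetric]
    by (subst sum_off_diagonal) (use n sym in \<open>auto simp: dyad_mean_def field_simps\<close>)
  have "(\<Sum>i\<in>{1..n}. (R i - m)\<^sup>2) = (\<Sum>i\<in>{1..n}. (R i)\<^sup>2) - 2 * m * (\<Sum>i\<in>{1..n}. R i) + real n * m\<^sup>2"
    by (simp add: power2_diff sum.distrib sum_subtractf sum_distrib_left mult_ac)
  also have "(\<Sum>i\<in>{1..n}. R i) = real n * m"
    unfolding R_def m_def by (rule mean)
  \<comment> \<open>The terms in \<open>m\<close> add up to - n m^2.\<close>
  also have "(\<Sum>i\<in>{1..n}. (R i)\<^sup>2) - 2 * m * (real n * m) + real n * m\<^sup>2 \<le> (\<Sum>i\<in>{1..n}. (R i)\<^sup>2)"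
    using mult_nonneg_nonneg[of "real n" "m\<^sup>2"] by (simp add: power2_eq_square algebra_simps)
  also have "\<dots> \<le> (\<Sum>i\<in>{1..n}. 1 / (real n - 1) * (\<Sum>j\<in>{1..n} - {i}. (f (z i j))\<^sup>2))"
  proof (rule sum_mono)
    fix i assume i: "i \<in> {1..n}"
    have "(\<Sum>j\<in>{1..n} - {i}. f (z i j))\<^sup>2 \<le> (\<Sum>j\<in>{1..n} - {i}. (f (z i j))\<^sup>2) * card ({1..n} - {i})"
      by (rule sum_squared_le_sum_of_squares)
    moreover have "real (card ({1..n} - {i})) = real n - 1"
      using i n by auto
    ultimately show "(R i)\<^sup>2 \<le> 1 / (real n - 1) * (\<Sum>j\<in>{1..n} - {i}. (f (z i j))\<^sup>2)"
      using n divide_right_mono[of _ _ "(real n - 1)\<^sup>2"]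
      unfolding R_def power_mult_distrib power_one_over by (fastforce simp: power2_eq_square)
  qed
  also have "\<dots> = real n * dyad_mean n z (\<lambda>x. (f x)\<^sup>2)"
    by (rule mean)
  finally have "1 / real n * (\<Sum>i\<in>{1..n}. (R i - m)\<^sup>2) \<le> dyad_mean n z (\<lambda>x. (f x)\<^sup>2)"
    using n by (simp add: pos_divide_le_eq mult.commute)
  then show ?thesis
    unfolding node_deviation_def real_sqrt_le_iff R_def m_def .
qed

section \<open>Perturbation of linear systems\<close>

lemma norm_matrix_vector_le: "norm (A *v x) \<le> norm A * norm x" for A :: "real ^ 'n ^ 'm"
proof -
  \<comment> \<open>The norm on matrices is the Frobenius norm, so Cauchy-Schwarz is applied to each
    row.\<close>
  have "norm (A *v x) \<le> L2_set (\<lambda>i. norm (A $ i) * norm x) UNIV"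
    unfolding norm_vec_def[of "A *v x"]
    by (intro L2_set_mono) (auto simp: matrix_vector_mul_component Cauchy_Schwarz_ineq2)
  also have "\<dots> = norm A * norm x"
    unfolding norm_vec_def[of A] by (simp add: L2_set_left_distrib)
  finally show ?thesis .
qed

lemma matrix_inv_solves: "invertible A \<Longrightarrow> A *v (matrix_inv A *v q) = q" for A :: "real ^ 'n ^ 'n"
  using someI_ex[of "\<lambda>B. A ** B = mat 1 \<and> B ** A = mat 1"]
  by (simp add: matrix_vector_mul_assoc invertible_def matrix_inv_def)

text \<open>A perturbation of size at most \<open>\<kappa> / 2\<close> leaves half of the lower
  bound, so \<open>Q'\<close> has trivial kernel and its inverse has norm at most
  \<open>2 / \<kappa>\<close>. The error \<open>w - v\<close> of the perturbed solution
  \<open>w\<close> satisfies Q' (w - v) = (q' - q) - (Q' - Q) v.\<close>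

lemma linear_system_perturbation:
  fixes Q Q' :: "real ^ 'n ^ 'n"
  assumes \<kappa>: "0 < \<kappa>" and Q: "\<And>v. \<kappa> * norm v \<le> norm (Q *v v)" and Q': "norm (Q' - Q) \<le> \<kappa> / 2"
  shows "invertible Q'"
    and "Q *v v = q \<Longrightarrow> norm (matrix_inv Q' *v q' - v) \<le> 2 / \<kappa> * (norm (q' - q) + norm (Q' - Q) * norm v)"
proof -
  have below: "\<kappa> / 2 * norm w \<le> norm (Q' *v w)" for w
  proof -
    have "norm ((Q' - Q) *v w) \<le> \<kappa> / 2 * norm w"
      by (rule order_trans[OF norm_matrix_vector_le]) (intro mult_right_mono Q' norm_ge_zero)
    moreover have "Q *v w = Q' *v w - (Q' - Q) *v w"
      by (simp add: matrix_vector_mult_diff_rdistrib)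
    ultimately show ?thesis
      using Q[of w] norm_triangle_ineq4[of "Q' *v w" "(Q' - Q) *v w"] by simp
  qed
  show inv: "invertible Q'"
    unfolding invertible_left_inverse matrix_left_invertible_ker
  proof safe
    fix w assume "Q' *v w = 0"
    with below[of w] \<kappa> show "w = 0" by (simp add: mult_le_0_iff)
  qed
  assume v: "Q *v v = q"
  let ?w = "matrix_inv Q' *v q' - v"
  have "Q' *v ?w = (q' - q) - (Q' - Q) *v v"
    by (simp add: matrix_vector_mult_diff_distrib matrix_vector_mult_diff_rdistrib matrix_inv_solves inv v)
  then have "norm (Q' *v ?w) \<le> norm (q' - q) + norm (Q' - Q) * norm v"
    using norm_triangle_ineq4[of "q' - q" "(Q' - Q) *v v"] norm_matrix_vector_le[of "Q' - Q" v] by simp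
  with below[of ?w] have "\<kappa> / 2 * norm ?w \<le> norm (q' - q) + norm (Q' - Q) * norm v" by linarith
  then show "norm ?w \<le> 2 / \<kappa> * (norm (q' - q) + norm (Q' - Q) * norm v)"
    using \<kappa> by (simp add: field_simps)
qed

section \<open>Events of high probability\<close>

text \<open>The exceptional set is contained in a measurable set of small probability; the predicate itself
  need not be measurable.\<close>

definition with_high_probability :: "'w measure \<Rightarrow> (nat \<Rightarrow> 'w \<Rightarrow> bool) \<Rightarrow> bool" where
  "with_high_probability M G \<longleftrightarrow> (\<forall>\<eta>>0. \<forall>\<^sub>F n in sequentially.
     \<exists>B\<in>sets M. measure M B \<le> \<eta> \<and> (\<forall>\<omega>\<in>space M - B. G n \<omega>))"

lemma with_high_probability_mono:
  assumes "with_high_probability M G"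
    and "\<forall>\<^sub>F n in sequentially. \<forall>\<omega>\<in>space M. G n \<omega> \<longrightarrow> H n \<omega>"
  shows "with_high_probability M H"
  unfolding with_high_probability_def
proof safe
  fix \<eta> :: real assume "\<eta> > 0"
  with assms(1) have "\<forall>\<^sub>F n in sequentially. \<exists>B\<in>sets M. measure M B \<le> \<eta> \<and> (\<forall>\<omega>\<in>space M - B. G n \<omega>)"
    unfolding with_high_probability_def by blast
  with assms(2) show "\<forall>\<^sub>F n in sequentially. \<exists>B\<in>sets M. measure M B \<le> \<eta> \<and> (\<forall>\<omega>\<in>space M - B. H n \<omega>)"
    by eventually_elim blast
qed

lemma with_high_probability_conj:
  assumes "with_high_probability M G" "with_high_probability M H" "finite_measure M"
  shows "with_high_probability M (\<lambda>n \<omega>. G n \<omega> \<and> H n \<omega>)"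
  unfolding with_high_probability_def
proof safe
  interpret finite_measure M by fact
  fix \<eta> :: real assume "\<eta> > 0"
  then have "\<forall>\<^sub>F n in sequentially. \<exists>B\<in>sets M. measure M B \<le> \<eta> / 2 \<and> (\<forall>\<omega>\<in>space M - B. G n \<omega>)"
    "\<forall>\<^sub>F n in sequentially. \<exists>B\<in>sets M. measure M B \<le> \<eta> / 2 \<and> (\<forall>\<omega>\<in>space M - B. H n \<omega>)"
    using assms(1,2) unfolding with_high_probability_def by (meson half_gt_zero)+
  then show "\<forall>\<^sub>F n in sequentially. \<exists>B\<in>sets M. measure M B \<le> \<eta> \<and> (\<forall>\<omega>\<in>space M - B. G n \<omega> \<and> H n \<omega>)"
  proof eventually_elim
    case (elim n)
    then obtain A B where "A \<in> sets M" "measure M A \<le> \<eta> / 2" "\<forall>\<omega>\<in>space M - A. G n \<omega>"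
      "B \<in> sets M" "measure M B \<le> \<eta> / 2" "\<forall>\<omega>\<in>space M - B. H n \<omega>" by blast
    with measure_Un_le[of A M B] show ?case
      by (intro bexI[of _ "A \<union> B"]) auto
  qed
qed

lemma with_high_probability_ball:
  assumes "finite I" "\<And>i. i \<in> I \<Longrightarrow> with_high_probability M (G i)" "finite_measure M"
  shows "with_high_probability M (\<lambda>n \<omega>. \<forall>i\<in>I. G i n \<omega>)"
  using assms(1,2)
proof (induction I)
  case empty
  then show ?case
    by (auto simp: with_high_probability_def intro!: always_eventually bexI[of _ "{}"])
next
  case (insert i I)
  then show ?case
    using with_high_probability_conj[OF _ _ assms(3), of "G i" "\<lambda>n \<omega>. \<forall>i\<in>I. G i n \<omega>"] by simp
qed

lemma small_o_p_oneI:
  assumes "finite_measure M"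
    and "\<And>\<epsilon>::real. \<epsilon> > 0 \<Longrightarrow> with_high_probability M (\<lambda>n \<omega>. \<bar>T n \<omega>\<bar> \<le> ereal \<epsilon>)"
  shows "small_o_p_one M T"
  unfolding small_o_p_one_def
proof safe
  interpret finite_measure M by fact
  fix \<epsilon> :: real assume \<epsilon>: "\<epsilon> > 0"
  show "(\<lambda>n. outer_measure_of M {\<omega> \<in> space M. ereal \<epsilon> < \<bar>T n \<omega>\<bar>}) \<longlonglongrightarrow> 0"
  proof (rule order_tendstoI)
    fix a :: ennreal assume "0 < a"
    \<comment> \<open>The level \<open>a\<close> may be infinite; a finite positive level below it
      is chosen so that a real tolerance is available.\<close>
    then obtain \<eta> where \<eta>: "0 < \<eta>" "\<eta> < a" using dense by blast
    then obtain e where e: "\<eta> = ennreal e" "e > 0"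
      by (cases \<eta>) (auto simp: top_unique)
    have "\<forall>\<^sub>F n in sequentially. \<exists>B\<in>sets M. measure M B \<le> e \<and> (\<forall>\<omega>\<in>space M - B. \<bar>T n \<omega>\<bar> \<le> ereal \<epsilon>)"
      using assms(2)[OF \<epsilon>] e(2) unfolding with_high_probability_def by blast
    then show "\<forall>\<^sub>F n in sequentially. outer_measure_of M {\<omega> \<in> space M. ereal \<epsilon> < \<bar>T n \<omega>\<bar>} < a"
    proof eventually_elim
      case (elim n)
      then obtain B where B: "B \<in> sets M" "measure M B \<le> e" "\<forall>\<omega>\<in>space M - B. \<bar>T n \<omega>\<bar> \<le> ereal \<epsilon>"
        by blast
      then have "outer_measure_of M {\<omega> \<in> space M. ereal \<epsilon> < \<bar>T n \<omega>\<bar>} \<le> emeasure M B"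
        unfolding outer_measure_of_def by (intro INF_lower) (auto simp: not_less[symmetric])
      also have "\<dots> \<le> ennreal e"
        using B by (simp add: emeasure_eq_measure ennreal_leI)
      finally show ?case using \<eta> e by auto
    qed
  qed simp
qed

section \<open>Law of large numbers for dyadic means\<close>

locale dyadic_sample =
  fixes M :: "'w measure" and NU :: "'u measure" and NV :: "'v measure"
    and U :: "nat \<Rightarrow> 'w \<Rightarrow> 'u" and V :: "nat \<Rightarrow> nat \<Rightarrow> 'w \<Rightarrow> 'v"
    and \<tau> :: "'u \<times> 'u \<times> 'v \<Rightarrow> 'z::topological_space"
  assumes sampling: "dyadic_sampling M NU NV U V"
    and tau_measurable[measurable]: "\<tau> \<in> measurable (NU \<Otimes>\<^sub>M NU \<Otimes>\<^sub>M NV) borel"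

sublocale dyadic_sample \<subseteq> prob_space M
  using sampling by (simp add: dyadic_sampling_def)

text \<open>A product measure is determined by its values on rectangles. Factorization is asked for
  event by event because node and dyad variables take values in different types, and because
  independence will come from generated sigma-algebras.\<close>

lemma (in prob_space) distr_pair_eqI:
  assumes X: "X \<in> measurable M S" and Y: "Y \<in> measurable M T"
    and indep: "\<And>A B. A \<in> sets S \<Longrightarrow> B \<in> sets T \<Longrightarrow>
      prob ((X -` A \<inter> space M) \<inter> (Y -` B \<inter> space M)) = prob (X -` A \<inter> space M) * prob (Y -` B \<inter> space M)"
  shows "distr M (S \<Otimes>\<^sub>M T) (\<lambda>\<omega>. (X \<omega>, Y \<omega>)) = distr M S X \<Otimes>\<^sub>M distr M T Y"
proof (rule pair_measure_eqI[symmetric])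
  show "sigma_finite_measure (distr M S X)" "sigma_finite_measure (distr M T Y)"
    by (intro prob_space_imp_sigma_finite prob_space_distr X Y)+
  have XY: "(\<lambda>\<omega>. (X \<omega>, Y \<omega>)) \<in> measurable M (S \<Otimes>\<^sub>M T)"
    by (rule measurable_Pair[OF X Y])
  fix A B assume "A \<in> sets (distr M S X)" "B \<in> sets (distr M T Y)"
  then have AB: "A \<in> sets S" "B \<in> sets T" by auto
  have "(\<lambda>\<omega>. (X \<omega>, Y \<omega>)) -` (A \<times> B) \<inter> space M = (X -` A \<inter> space M) \<inter> (Y -` B \<inter> space M)"
    by auto
  then show "emeasure (distr M S X) A * emeasure (distr M T Y) B =
      emeasure (distr M (S \<Otimes>\<^sub>M T) (\<lambda>\<omega>. (X \<omega>, Y \<omega>))) (A \<times> B)"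
    using indep[OF AB] AB by (simp add: emeasure_distr X Y XY emeasure_eq_measure ennreal_mult)
qed simp

section \<open>Law and independence of the dyad observations\<close>

context dyadic_sample
begin

definition node_dyad_events :: "nat + nat \<times> nat \<Rightarrow> 'w set set" where
  "node_dyad_events = case_sum (\<lambda>i. preimages M NU (U i)) (\<lambda>(i, j). preimages M NV (V i j))"

text \<open>The information carried by the sources in \<open>K\<close>, nodes as \<open>Inl\<close>
  and dyads as \<open>Inr\<close>. It is packaged as a measure space so that measurability of a
  function with respect to it can be stated.\<close>

definition generated :: "(nat + nat \<times> nat) set \<Rightarrow> 'w measure" where
  "generated K = sigma (space M) (\<Union>k\<in>K. node_dyad_events k)"

lemma space_generated[simp]: "space (generated K) = space M"
  by (simp add: generated_def space_measure_of_conv)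

lemma sets_generated: "sets (generated K) = sigma_sets (space M) (\<Union>k\<in>K. node_dyad_events k)"
  unfolding generated_def
  by (rule sets_measure_of) (auto simp: node_dyad_events_def preimages_def split: sum.splits)

abbreviation "indices \<equiv> Inl ` {1..} \<union> Inr ` dyad_indices"

text \<open>Preimages commute with intersection, so each source contributes an intersection-stable
  family; disjoint groups of such independent families generate independent sigma-algebras.\<close>

lemma indep_generated:
  assumes "K \<union> L \<subseteq> indices" "K \<inter> L = {}"
  shows "indep_set (sets (generated K)) (sets (generated L))"
proof -
  have "indep_sets (\<lambda>b. sigma_sets (space M) (\<Union>k\<in>case_bool K L b. node_dyad_events k)) UNIV"
  proof (rule indep_sets_collect_sigma)
    have "indep_sets node_dyad_events indices"
      using sampling by (simp add: dyadic_sampling_def node_dyad_events_def)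
    then show "indep_sets node_dyad_events (\<Union>b. case_bool K L b)"
      by (rule indep_sets_mono_index[rotated]) (use assms in \<open>auto simp: UNIV_bool\<close>)
    show "disjoint_family (case_bool K L)"
      using assms by (auto simp: disjoint_family_on_def split: bool.splits)
    show "Int_stable (node_dyad_events k)" for k
      unfolding Int_stable_def node_dyad_events_def preimages_def
      by (auto split: sum.splits) (metis sets.Int vimage_Int Int_assoc Int_left_absorb Int_commute)+
  qed
  also have "(\<lambda>b. sigma_sets (space M) (\<Union>k\<in>case_bool K L b. node_dyad_events k)) =
      case_bool (sets (generated K)) (sets (generated L))"
    by (auto simp: fun_eq_iff sets_generated split: bool.splits)
  finally show ?thesis
    by (simp add: indep_set_def)
qed

lemma node_measurable: "1 \<le> i \<Longrightarrow> U i \<in> measurable M NU"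
  and dyad_measurable: "1 \<le> i \<Longrightarrow> i < j \<Longrightarrow> V i j \<in> measurable M NV"
  using sampling by (auto simp: dyadic_sampling_def dyad_indices_def)

lemma node_distr: "1 \<le> i \<Longrightarrow> distr M NU (U i) = distr M NU (U 1)"
  and dyad_distr: "1 \<le> i \<Longrightarrow> i < j \<Longrightarrow> distr M NV (V i j) = distr M NV (V 1 2)"
  using sampling unfolding dyadic_sampling_def dyad_indices_def by blast+

lemma node_generated:
  assumes "1 \<le> i" "Inl i \<in> K" shows "U i \<in> measurable (generated K) NU"
proof (rule measurableI)
  fix A assume "A \<in> sets NU"
  then have "U i -` A \<inter> space M \<in> (\<Union>k\<in>K. node_dyad_events k)"
    using assms by (force simp: node_dyad_events_def preimages_def)
  then show "U i -` A \<inter> space (generated K) \<in> sets (generated K)"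
    by (simp add: sets_generated sigma_sets.Basic)
qed (use measurable_space[OF node_measurable] assms in auto)

lemma dyad_generated:
  assumes "1 \<le> i" "i < j" "Inr (i, j) \<in> K" shows "V i j \<in> measurable (generated K) NV"
proof (rule measurableI)
  fix A assume "A \<in> sets NV"
  then have "V i j -` A \<inter> space M \<in> (\<Union>k\<in>K. node_dyad_events k)"
    using assms by (force simp: node_dyad_events_def preimages_def)
  then show "V i j -` A \<inter> space (generated K) \<in> sets (generated K)"
    by (simp add: sets_generated sigma_sets.Basic)
qed (use measurable_space[OF dyad_measurable] assms in auto)

abbreviation Z :: "'w \<Rightarrow> nat \<Rightarrow> nat \<Rightarrow> 'z" where "Z \<equiv> dyad_obs \<tau> U V"

lemma Z_less: "i < j \<Longrightarrow> (\<lambda>\<omega>. Z \<omega> i j) = (\<lambda>\<omega>. \<tau> (U i \<omega>, U j \<omega>, V i j \<omega>))"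
  by (simp add: dyad_obs_def)

lemma Z_sym: "i \<noteq> j \<Longrightarrow> Z \<omega> i j = Z \<omega> j i"
  by (auto simp: dyad_obs_def)

lemma Z_measurable: "1 \<le> i \<Longrightarrow> i < j \<Longrightarrow> (\<lambda>\<omega>. Z \<omega> i j) \<in> borel_measurable M"
  by (simp add: Z_less measurable_compose[OF _ tau_measurable] measurable_Pair node_measurable dyad_measurable)

lemma Z_generated:
  assumes "1 \<le> i" "i < j"
  shows "(\<lambda>\<omega>. Z \<omega> i j) \<in> borel_measurable (generated {Inl i, Inl j, Inr (i, j)})"
  using assms
  by (simp add: Z_less measurable_compose[OF _ tau_measurable] measurable_Pair node_generated dyad_generated)

text \<open>Independence turns the joint law of the three sources into a product, peeled off along
  the nesting of the tuple, and no factor depends on the indices. Hence all dyad observations have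
  the same law.\<close>

lemma distr_triple:
  assumes ij: "1 \<le> i" "i < j"
  shows "distr M (NU \<Otimes>\<^sub>M NU \<Otimes>\<^sub>M NV) (\<lambda>\<omega>. (U i \<omega>, U j \<omega>, V i j \<omega>)) =
    distr M NU (U 1) \<Otimes>\<^sub>M distr M NU (U 1) \<Otimes>\<^sub>M distr M NV (V 1 2)"
proof -
  note meas = node_measurable dyad_measurable
  have UV: "(\<lambda>\<omega>. (U j \<omega>, V i j \<omega>)) \<in> measurable (generated {Inl j, Inr (i, j)}) (NU \<Otimes>\<^sub>M NV)"
    by (intro measurable_Pair node_generated dyad_generated) (use ij in auto)
  have Ui: "U i \<in> measurable (generated {Inl i}) NU" and Uj: "U j \<in> measurable (generated {Inl j}) NU"
    and Vij: "V i j \<in> measurable (generated {Inr (i, j)}) NV"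
    using ij by (auto intro!: node_generated dyad_generated)
  have idx: "Inl i \<in> indices" "Inl j \<in> indices" "Inr (i, j) \<in> indices"
    using ij by (auto simp: dyad_indices_def)
  have "distr M (NU \<Otimes>\<^sub>M NV) (\<lambda>\<omega>. (U j \<omega>, V i j \<omega>)) = distr M NU (U j) \<Otimes>\<^sub>M distr M NV (V i j)"
  proof (rule distr_pair_eqI)
    have *: "indep_set (sets (generated {Inl j})) (sets (generated {Inr (i, j)}))"
      by (rule indep_generated) (use idx in auto)
    fix A B assume "A \<in> sets NU" "B \<in> sets NV"
    then show "prob ((U j -` A \<inter> space M) \<inter> (V i j -` B \<inter> space M)) =
        prob (U j -` A \<inter> space M) * prob (V i j -` B \<inter> space M)"
      by (intro indep_setD[OF *]) (use measurable_sets[OF Uj] measurable_sets[OF Vij] in auto)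
  qed (use ij in \<open>auto intro!: meas\<close>)
  moreover have "distr M (NU \<Otimes>\<^sub>M NU \<Otimes>\<^sub>M NV) (\<lambda>\<omega>. (U i \<omega>, U j \<omega>, V i j \<omega>)) =
      distr M NU (U i) \<Otimes>\<^sub>M distr M (NU \<Otimes>\<^sub>M NV) (\<lambda>\<omega>. (U j \<omega>, V i j \<omega>))"
  proof (rule distr_pair_eqI)
    have *: "indep_set (sets (generated {Inl i})) (sets (generated {Inl j, Inr (i, j)}))"
      by (rule indep_generated) (use idx ij in auto)
    fix A B assume "A \<in> sets NU" "B \<in> sets (NU \<Otimes>\<^sub>M NV)"
    then show "prob ((U i -` A \<inter> space M) \<inter> ((\<lambda>\<omega>. (U j \<omega>, V i j \<omega>)) -` B \<inter> space M)) =
        prob (U i -` A \<inter> space M) * prob ((\<lambda>\<omega>. (U j \<omega>, V i j \<omega>)) -` B \<inter> space M)"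
      by (intro indep_setD[OF *]) (use measurable_sets[OF Ui] measurable_sets[OF UV] in auto)
  qed (use ij in \<open>auto intro!: meas measurable_Pair\<close>)
  moreover have "distr M NU (U i) = distr M NU (U 1)" "distr M NU (U j) = distr M NU (U 1)"
    "distr M NV (V i j) = distr M NV (V 1 2)"
    by (rule node_distr dyad_distr; use ij in simp)+
  ultimately show ?thesis by simp
qed

lemma distr_Z:
  assumes "1 \<le> i" "i < j"
  shows "distr M borel (\<lambda>\<omega>. Z \<omega> i j) = distr M borel (\<lambda>\<omega>. Z \<omega> 1 2)"
proof -
  have "distr M borel (\<lambda>\<omega>. Z \<omega> i j) =
      distr (distr M NU (U 1) \<Otimes>\<^sub>M distr M NU (U 1) \<Otimes>\<^sub>M distr M NV (V 1 2)) borel \<tau>"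
    if "1 \<le> i" "i < j" for i j
    unfolding Z_less[OF that(2)] distr_triple[OF that, symmetric]
    by (subst distr_distr)
      (use that in \<open>auto intro!: measurable_Pair node_measurable dyad_measurable tau_measurable simp: comp_def\<close>)
  from this[OF assms] this[of 1 2] show ?thesis by simp
qed

context
  fixes f :: "'z \<Rightarrow> real"
  assumes f[measurable]: "f \<in> borel_measurable borel"
begin

lemma f_Z_measurable: "1 \<le> i \<Longrightarrow> i < j \<Longrightarrow> (\<lambda>\<omega>. f (Z \<omega> i j)) \<in> borel_measurable M"
  by (rule measurable_compose[OF Z_measurable f])

lemma integrable_Z:
  assumes "1 \<le> i" "i < j"
  shows "integrable M (\<lambda>\<omega>. f (Z \<omega> i j)) \<longleftrightarrow> integrable M (\<lambda>\<omega>. f (Z \<omega> 1 2))"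
proof -
  have "integrable M (\<lambda>\<omega>. f (Z \<omega> i j)) \<longleftrightarrow> integrable (distr M borel (\<lambda>\<omega>. Z \<omega> i j)) f"
    if "1 \<le> i" "i < j" for i j
    using Z_measurable[OF that] by (simp add: integrable_distr_eq)
  with distr_Z[OF assms] assms show ?thesis by simp
qed

lemma integral_Z:
  assumes "1 \<le> i" "i < j"
  shows "(\<integral>\<omega>. f (Z \<omega> i j) \<partial>M) = (\<integral>\<omega>. f (Z \<omega> 1 2) \<partial>M)"
proof -
  have "(\<integral>\<omega>. f (Z \<omega> i j) \<partial>M) = integral\<^sup>L (distr M borel (\<lambda>\<omega>. Z \<omega> i j)) f"
    if "1 \<le> i" "i < j" for i j
    using Z_measurable[OF that] by (simp add: integral_distr)
  with distr_Z[OF assms] assms show ?thesis by simp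
qed

end

text \<open>An observation depends only on its two nodes and its own dyad variable. If two dyads
  share no node, these triples of sources are disjoint.\<close>

lemma indep_var_Z:
  fixes f :: "'z \<Rightarrow> real"
  assumes f: "f \<in> borel_measurable borel"
    and ij: "1 \<le> i" "i < j" and kl: "1 \<le> k" "k < l" and disj: "{i, j} \<inter> {k, l} = {}"
  shows "indep_var borel (\<lambda>\<omega>. f (Z \<omega> i j)) borel (\<lambda>\<omega>. f (Z \<omega> k l))"
  unfolding indep_var_eq
proof (intro conjI)
  let ?K = "{Inl i, Inl j, Inr (i, j)}" and ?L = "{Inl k, Inl l, Inr (k, l)}"
  have indep: "indep_set (sets (generated ?K)) (sets (generated ?L))"
    by (rule indep_generated) (use ij kl disj in \<open>auto simp: dyad_indices_def\<close>)
  have *: "sigma_sets (space M) {(\<lambda>\<omega>. f (Z \<omega> i j)) -` A \<inter> space M |A. A \<in> sets borel}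
      \<subseteq> sets (generated {Inl i, Inl j, Inr (i, j)})" if "1 \<le> i" "i < j" for i j
    using measurable_sets[OF measurable_compose[OF Z_generated[OF that] f]]
    by (intro sets.sigma_sets_subset[of _ "generated _", simplified space_generated]) auto
  show "indep_set (sigma_sets (space M) {(\<lambda>\<omega>. f (Z \<omega> i j)) -` A \<inter> space M |A. A \<in> sets borel})
     (sigma_sets (space M) {(\<lambda>\<omega>. f (Z \<omega> k l)) -` A \<inter> space M |A. A \<in> sets borel})"
    using indep *[OF ij] *[OF kl] unfolding indep_set_def
    by (elim indep_sets_mono_sets) (auto split: bool.splits)
qed (intro f_Z_measurable f ij kl)+

end

section \<open>Variance bound and weak law for dyadic means\<close>

context dyadic_sample
begin

text \<open>Dyads without a common node are independent, and a dyad shares a node with at most \<open>4 n\<close> others.\<close>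

lemma second_moment_sum:
  fixes g :: "'z \<Rightarrow> real" and n :: nat
  assumes g[measurable]: "g \<in> borel_measurable borel"
    and sq: "integrable M (\<lambda>\<omega>. (g (Z \<omega> 1 2))\<^sup>2)" and mean: "(\<integral>\<omega>. g (Z \<omega> 1 2) \<partial>M) = 0"
  defines "D \<equiv> {(i, j). 1 \<le> i \<and> i < j \<and> j \<le> n}"
  shows "integrable M (\<lambda>\<omega>. (\<Sum>(i, j)\<in>D. g (Z \<omega> i j))\<^sup>2)"
    and "(\<integral>\<omega>. (\<Sum>(i, j)\<in>D. g (Z \<omega> i j))\<^sup>2 \<partial>M) \<le> real (card D) * (4 * real n) * (\<integral>\<omega>. (g (Z \<omega> 1 2))\<^sup>2 \<partial>M)"
proof -
  define G where "G p \<omega> = g (Z \<omega> (fst p) (snd p))" for p :: "nat \<times> nat" and \<omega>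
  define \<sigma> where "\<sigma> = (\<integral>\<omega>. (g (Z \<omega> 1 2))\<^sup>2 \<partial>M)"
  define meets where "meets p q \<longleftrightarrow> {fst p, snd p} \<inter> {fst q, snd q} \<noteq> {}" for p q :: "nat \<times> nat"
  have D: "1 \<le> fst p" "fst p < snd p" if "p \<in> D" for p
    using that by (auto simp: D_def)
  have finD: "finite D"
    unfolding D_def by (rule finite_dyads)
  have g2: "(\<lambda>z. (g z)\<^sup>2) \<in> borel_measurable borel" by measurable
  have G_meas[measurable]: "G p \<in> borel_measurable M" if "p \<in> D" for p
    unfolding G_def using f_Z_measurable[OF g D[OF that]] .
  have G_sq: "integrable M (\<lambda>\<omega>. (G p \<omega>)\<^sup>2)" and G_var: "(\<integral>\<omega>. (G p \<omega>)\<^sup>2 \<partial>M) = \<sigma>" if "p \<in> D" for p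
    using integrable_Z[OF g2 D[OF that]] integral_Z[OF g2 D[OF that]] sq by (simp_all add: G_def \<sigma>_def)
  have G_mean: "(\<integral>\<omega>. G p \<omega> \<partial>M) = 0" if "p \<in> D" for p
    using integral_Z[OF g D[OF that]] mean by (simp add: G_def)
  \<comment> \<open>This gives integrability of every product and, as both squares have mean
    \<open>\<sigma>\<close>, the bound \<open>\<sigma>\<close> for dyads that meet.\<close>
  have am_gm: "\<bar>a * b\<bar> \<le> (a\<^sup>2 + b\<^sup>2) / 2" for a b :: real
    using sum_squares_bound[of a b] sum_squares_bound[of a "- b"] by (auto simp: abs_if)
  have prod_int: "integrable M (\<lambda>\<omega>. G p \<omega> * G q \<omega>)" if "p \<in> D" "q \<in> D" for p q
  proof (rule Bochner_Integration.integrable_bound)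
    show "integrable M (\<lambda>\<omega>. ((G p \<omega>)\<^sup>2 + (G q \<omega>)\<^sup>2) / 2)"
      using G_sq that by simp
    show "AE \<omega> in M. norm (G p \<omega> * G q \<omega>) \<le> norm (((G p \<omega>)\<^sup>2 + (G q \<omega>)\<^sup>2) / 2)"
      using am_gm by (auto simp: abs_mult intro!: AE_I2)
  qed (use that in measurable)
  have prod_le: "(\<integral>\<omega>. G p \<omega> * G q \<omega> \<partial>M) \<le> (if meets p q then \<sigma> else 0)" if "p \<in> D" "q \<in> D" for p q
  proof (cases "meets p q")
    case True
    have "(\<integral>\<omega>. G p \<omega> * G q \<omega> \<partial>M) \<le> (\<integral>\<omega>. ((G p \<omega>)\<^sup>2 + (G q \<omega>)\<^sup>2) / 2 \<partial>M)"
      by (rule integral_mono[OF prod_int[OF that]]) (use G_sq that abs_le_D1[OF am_gm] in auto)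
    also have "\<dots> = \<sigma>"
      using G_sq G_var that by simp
    finally show ?thesis using True by simp
  next
    case False
    have "indep_var borel (G p) borel (G q)"
      using indep_var_Z[OF g D[OF that(1)] D[OF that(2)]] False by (simp add: G_def[abs_def] meets_def)
    moreover have "integrable M (G p)" "integrable M (G q)"
      using square_integrable_imp_integrable G_sq G_meas that by blast+
    ultimately have "(\<integral>\<omega>. G p \<omega> * G q \<omega> \<partial>M) = (\<integral>\<omega>. G p \<omega> \<partial>M) * (\<integral>\<omega>. G q \<omega> \<partial>M)"
      by (rule indep_var_lebesgue_integral)
    also have "\<dots> = 0"
      using G_mean[OF that(1)] by simp
    finally have "(\<integral>\<omega>. G p \<omega> * G q \<omega> \<partial>M) = 0" .
    with False show ?thesis by simp
  qed
  \<comment> \<open>A dyad meeting \<open>p\<close> has one of the two nodes of \<open>p\<close> in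
    one of two positions, and at most \<open>n\<close> choices for the other entry.\<close>
  have meets_card: "real (card {q \<in> D. meets p q}) \<le> 4 * real n" for p
  proof -
    have "{q \<in> D. meets p q} \<subseteq> {fst p, snd p} \<times> {1..n} \<union> {1..n} \<times> {fst p, snd p}"
      by (auto simp: D_def meets_def)
    then have "card {q \<in> D. meets p q} \<le> card ({fst p, snd p} \<times> {1..n} \<union> {1..n} \<times> {fst p, snd p})"
      by (rule card_mono[rotated]) auto
    also have "\<dots> \<le> card {fst p, snd p} * n + n * card {fst p, snd p}"
      by (rule card_Un_le[THEN order_trans]) (simp add: card_cartesian_product)
    also have "\<dots> \<le> 4 * n"
      by (cases "fst p = snd p") auto
    finally show ?thesis by simp
  qed
  have expand: "(\<Sum>(i, j)\<in>D. g (Z \<omega> i j))\<^sup>2 = (\<Sum>p\<in>D. \<Sum>q\<in>D. G p \<omega> * G q \<omega>)" for \<omega>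
    by (simp add: power2_eq_square sum_product G_def case_prod_unfold)
  show "integrable M (\<lambda>\<omega>. (\<Sum>(i, j)\<in>D. g (Z \<omega> i j))\<^sup>2)"
    unfolding expand by (intro Bochner_Integration.integrable_sum prod_int)
  have "(\<integral>\<omega>. (\<Sum>(i, j)\<in>D. g (Z \<omega> i j))\<^sup>2 \<partial>M) = (\<Sum>p\<in>D. \<Sum>q\<in>D. \<integral>\<omega>. G p \<omega> * G q \<omega> \<partial>M)"
    unfolding expand by (simp add: Bochner_Integration.integral_sum prod_int)
  also have "\<dots> \<le> (\<Sum>p\<in>D. \<Sum>q\<in>D. if meets p q then \<sigma> else 0)"
    by (intro sum_mono prod_le)
  also have "\<dots> = (\<Sum>p\<in>D. real (card {q \<in> D. meets p q}) * \<sigma>)"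
    using finD by (simp add: sum.inter_filter[symmetric])
  also have "\<dots> \<le> (\<Sum>p\<in>D. 4 * real n * \<sigma>)"
    by (intro sum_mono mult_right_mono meets_card) (simp add: \<sigma>_def)
  finally show "(\<integral>\<omega>. (\<Sum>(i, j)\<in>D. g (Z \<omega> i j))\<^sup>2 \<partial>M) \<le> real (card D) * (4 * real n) * (\<integral>\<omega>. (g (Z \<omega> 1 2))\<^sup>2 \<partial>M)"
    by (simp add: \<sigma>_def)
qed

text \<open>Chebyshev's inequality for the centred sum. With N dyads its second moment is at most 4
  n N \<open>\<sigma>\<close>, of smaller order than N^2.\<close>

lemma law_of_large_numbers_real:
  fixes f :: "'z \<Rightarrow> real"
  assumes f[measurable]: "f \<in> borel_measurable borel"
    and sq: "integrable M (\<lambda>\<omega>. (f (Z \<omega> 1 2))\<^sup>2)" and \<theta>: "0 < \<theta>"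
  shows "with_high_probability M (\<lambda>n \<omega>. \<bar>dyad_mean n (Z \<omega>) f - (\<integral>\<omega>. f (Z \<omega> 1 2) \<partial>M)\<bar> < \<theta>)"
  unfolding with_high_probability_def
proof safe
  fix \<eta> :: real assume \<eta>: "\<eta> > 0"
  define m where "m = (\<integral>\<omega>. f (Z \<omega> 1 2) \<partial>M)"
  define g where "g z = f z - m" for z
  define \<sigma> where "\<sigma> = (\<integral>\<omega>. (g (Z \<omega> 1 2))\<^sup>2 \<partial>M)"
  have f_meas: "(\<lambda>\<omega>. f (Z \<omega> 1 2)) \<in> borel_measurable M"
    by (rule f_Z_measurable) (auto intro: f)
  have int: "integrable M (\<lambda>\<omega>. f (Z \<omega> 1 2))"
    by (rule square_integrable_imp_integrable[OF f_meas sq])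
  have g: "g \<in> borel_measurable borel" unfolding g_def[abs_def] by measurable
  have g_sq: "integrable M (\<lambda>\<omega>. (g (Z \<omega> 1 2))\<^sup>2)"
    unfolding g_def power2_diff using int sq by simp
  have g_mean: "(\<integral>\<omega>. g (Z \<omega> 1 2) \<partial>M) = 0"
    unfolding g_def using int by (simp add: m_def prob_space)
  \<comment> \<open>The Chebyshev bound below, required to be at most \<open>\<eta>\<close> and
    solved for \<open>n\<close>. The 8 is the 4 from counting dyads that meet, times the 2 from N =
    n (n - 1) / 2.\<close>
  have "\<forall>\<^sub>F n in sequentially. 8 * \<sigma> / (\<theta>\<^sup>2 * \<eta>) \<le> real n - 1"
    by real_asymp
  with eventually_ge_at_top[of 2]
  show "\<forall>\<^sub>F n in sequentially. \<exists>B\<in>sets M. measure M B \<le> \<eta> \<and>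
      (\<forall>\<omega>\<in>space M - B. \<bar>dyad_mean n (Z \<omega>) f - (\<integral>\<omega>. f (Z \<omega> 1 2) \<partial>M)\<bar> < \<theta>)"
  proof eventually_elim
    case (elim n)
    define N where "N = real n * (real n - 1) / 2"
    define S where "S \<omega> = (\<Sum>(i, j)\<in>{(i, j). 1 \<le> i \<and> i < j \<and> j \<le> n}. g (Z \<omega> i j))" for \<omega>
    have N: "N > 0" using elim by (simp add: N_def)
    have S_meas[measurable]: "S \<in> borel_measurable M"
      unfolding S_def[abs_def] case_prod_unfold by (intro borel_measurable_sum f_Z_measurable g) auto
    have "measure M {\<omega> \<in> space M. \<bar>S \<omega>\<bar> \<ge> \<theta> * N} \<le> (\<integral>\<omega>. (S \<omega>)\<^sup>2 \<partial>M) / (\<theta> * N)\<^sup>2"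
    proof (rule second_moment_method[OF S_meas])
      show "integrable M (\<lambda>\<omega>. (S \<omega>)\<^sup>2)"
        unfolding S_def by (rule second_moment_sum(1)[OF g g_sq g_mean])
    qed (use \<theta> N in simp)
    also have "\<dots> \<le> (N * (4 * real n) * \<sigma>) / (\<theta> * N)\<^sup>2"
      using second_moment_sum(2)[OF g g_sq g_mean, of n] unfolding S_def \<sigma>_def N_def card_dyads
      by (rule divide_right_mono) simp
    also have "\<dots> = 4 * real n * \<sigma> / (\<theta>\<^sup>2 * N)"
      using N by (simp add: power2_eq_square)
    also have "\<dots> = 8 * \<sigma> / (\<theta>\<^sup>2 * (real n - 1))"
      using elim by (simp add: N_def mult.left_commute[of _ "real n"])
    also have "\<dots> \<le> \<eta>"
      using elim \<theta> \<eta> by (simp add: field_simps)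
    finally have "measure M {\<omega> \<in> space M. \<bar>S \<omega>\<bar> \<ge> \<theta> * N} \<le> \<eta>" .
    moreover have "\<bar>dyad_mean n (Z \<omega>) f - m\<bar> < \<theta>" if "\<not> \<theta> * N \<le> \<bar>S \<omega>\<bar>" for \<omega>
    proof -
      have "dyad_mean n (Z \<omega>) f = dyad_mean n (Z \<omega>) g + m"
        using elim dyad_mean_add[of n "Z \<omega>" g "\<lambda>_. m"] dyad_mean_const[of n "Z \<omega>" m] by (simp add: g_def)
      moreover have "dyad_mean n (Z \<omega>) g = S \<omega> / N"
        by (simp only: dyad_mean_def S_def N_def real_scaleR_def divide_inverse mult.commute)
      ultimately have "\<bar>dyad_mean n (Z \<omega>) f - m\<bar> = \<bar>S \<omega>\<bar> / N"
        using N by simp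
      then show ?thesis
        using that N by (simp add: divide_less_eq)
    qed
    ultimately show ?case
      unfolding m_def by (intro bexI[of _ "{\<omega> \<in> space M. \<bar>S \<omega>\<bar> \<ge> \<theta> * N}"]) auto
  qed
qed

lemma law_of_large_numbers:
  fixes f :: "'z \<Rightarrow> 'b::euclidean_space"
  assumes f[measurable]: "f \<in> borel_measurable borel"
    and sq: "integrable M (\<lambda>\<omega>. (norm (f (Z \<omega> 1 2)))\<^sup>2)" and \<theta>: "0 < \<theta>"
  shows "with_high_probability M (\<lambda>n \<omega>. norm (dyad_mean n (Z \<omega>) f - (\<integral>\<omega>. f (Z \<omega> 1 2) \<partial>M)) < \<theta>)"
proof -
  let ?m = "\<integral>\<omega>. f (Z \<omega> 1 2) \<partial>M" and ?d = "real DIM('b)"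
  have f_meas[measurable]: "(\<lambda>\<omega>. f (Z \<omega> 1 2)) \<in> borel_measurable M"
    by (rule measurable_compose[OF Z_measurable f]) auto
  have "integrable M (\<lambda>\<omega>. norm (f (Z \<omega> 1 2)))"
    by (rule square_integrable_imp_integrable[OF _ sq]) measurable
  then have int: "integrable M (\<lambda>\<omega>. f (Z \<omega> 1 2))"
    using integrable_norm_iff[OF f_meas] by simp
  \<comment> \<open>The Euclidean norm is at most the sum of the absolute coordinates, so each
    coordinate receives an equal share of \<open>\<theta>\<close>.\<close>
  have "with_high_probability M (\<lambda>n \<omega>. \<forall>b\<in>Basis. \<bar>dyad_mean n (Z \<omega>) (\<lambda>z. f z \<bullet> b) -
      (\<integral>\<omega>. f (Z \<omega> 1 2) \<bullet> b \<partial>M)\<bar> < \<theta> / ?d)"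
  proof (intro with_high_probability_ball law_of_large_numbers_real)
    fix b :: 'b assume b: "b \<in> Basis"
    show "integrable M (\<lambda>\<omega>. (f (Z \<omega> 1 2) \<bullet> b)\<^sup>2)"
      by (rule Bochner_Integration.integrable_bound[OF sq])
        (use b Basis_le_norm f_meas in \<open>auto intro!: AE_I2 simp: abs_le_square_iff[symmetric]\<close>)
  qed (use \<theta> finite_measure_axioms in auto)
  then show ?thesis
  proof (rule with_high_probability_mono, intro always_eventually allI ballI impI)
    fix n \<omega>
    assume *: "\<forall>b\<in>Basis. \<bar>dyad_mean n (Z \<omega>) (\<lambda>z. f z \<bullet> b) - (\<integral>\<omega>. f (Z \<omega> 1 2) \<bullet> b \<partial>M)\<bar> < \<theta> / ?d"
    have "norm (dyad_mean n (Z \<omega>) f - ?m) \<le> (\<Sum>b\<in>Basis. \<bar>(dyad_mean n (Z \<omega>) f - ?m) \<bullet> b\<bar>)"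
      by (rule norm_le_l1)
    also have "\<dots> < (\<Sum>b\<in>(Basis :: 'b set). \<theta> / ?d)"
      by (rule sum_strict_mono) (use * int in \<open>auto simp: inner_diff_left dyad_mean_inner\<close>)
    finally show "norm (dyad_mean n (Z \<omega>) f - ?m) < \<theta>"
      by simp
  qed
qed

end

section \<open>Uniform law of large numbers over orthants\<close>

text \<open>A bracket \<open>(L, D)\<close> replaces a down-set up to an error contained in \<open>D\<close>. Splitting off the
  grid points, which may be atoms, only leaves open intervals, whose mass vanishes as they shrink.\<close>

lemma interval_brackets:
  fixes P :: "real measure"
  assumes "finite_measure P" and sets_P: "sets P = sets borel" and \<epsilon>: "0 < \<epsilon>"
  obtains F where "finite F"
    and "\<And>L D. (L, D) \<in> F \<Longrightarrow> L \<in> sets borel \<and> D \<in> sets borel \<and> measure P D \<le> \<epsilon>"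
    and "\<And>s. s \<in> {a..b} \<Longrightarrow> \<exists>(L, D)\<in>F. \<forall>t. (t \<le> s) \<noteq> (t \<in> L) \<longrightarrow> t \<in> D"
proof -
  interpret finite_measure P by fact
  have "\<exists>\<eta>>0. measure P {t<..<t + \<eta>} \<le> \<epsilon> \<and> measure P {t - \<eta><..<t} \<le> \<epsilon>" for t
  proof -
    \<comment> \<open>Continuity from above. The intervals exclude \<open>t\<close> itself, so they
      shrink to the empty set even when \<open>t\<close> is an atom.\<close>
    have small: "\<forall>\<^sub>F n in sequentially. measure P (A n) < \<epsilon>"
      if "decseq A" "(\<Inter>n. A n) = {}" "\<And>n. A n \<in> sets borel" for A :: "nat \<Rightarrow> real set"
    proof -
      have "(\<lambda>n. measure P (A n)) \<longlonglongrightarrow> measure P (\<Inter>n. A n)"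
        by (rule finite_Lim_measure_decseq) (use that sets_P in auto)
      then show ?thesis
        using \<epsilon> that(2) by (auto elim: order_tendstoD)
    qed
    have inv_mono: "1 / (1 + real n) \<le> 1 / (1 + real m)" if "m \<le> n" for m n
      using that by (simp add: frac_le)
    have no_pos: "\<exists>n. \<not> x < 1 / (1 + real n)" if "x > 0" for x :: real
      using reals_Archimedean[OF that] by (auto simp: inverse_eq_divide add.commute intro: less_imp_le simp: not_less)
    have "\<forall>\<^sub>F n in sequentially. measure P {t<..<t + 1 / (1 + real n)} < \<epsilon>"
    proof (rule small)
      show "decseq (\<lambda>n. {t<..<t + 1 / (1 + real n)})"
        unfolding decseq_def using inv_mono by force
      show "(\<Inter>n. {t<..<t + 1 / (1 + real n)}) = {}"
      proof safe
        fix x assume "x \<in> (\<Inter>n. {t<..<t + 1 / (1 + real n)})"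
        then have "x - t > 0" "\<And>n. x - t < 1 / (1 + real n)" by (auto simp: algebra_simps)
        with no_pos show "x \<in> {}" by blast
      qed
    qed auto
    moreover have "\<forall>\<^sub>F n in sequentially. measure P {t - 1 / (1 + real n)<..<t} < \<epsilon>"
    proof (rule small)
      show "decseq (\<lambda>n. {t - 1 / (1 + real n)<..<t})"
        unfolding decseq_def using inv_mono by force
      show "(\<Inter>n. {t - 1 / (1 + real n)<..<t}) = {}"
      proof safe
        fix x assume "x \<in> (\<Inter>n. {t - 1 / (1 + real n)<..<t})"
        then have "t - x > 0" "\<And>n. t - x < 1 / (1 + real n)" by (auto simp: algebra_simps)
        with no_pos show "x \<in> {}" by blast
      qed
    qed auto
    ultimately obtain n where "measure P {t<..<t + 1 / (1 + real n)} < \<epsilon>" "measure P {t - 1 / (1 + real n)<..<t} < \<epsilon>"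
      using eventually_happens'[OF sequentially_bot eventually_conj] by blast
    then show ?thesis
      by (intro exI[of _ "1 / (1 + real n)"]) auto
  qed
  then obtain \<eta> where \<eta>: "\<And>t. \<eta> t > 0" "\<And>t. measure P {t<..<t + \<eta> t} \<le> \<epsilon>" "\<And>t. measure P {t - \<eta> t<..<t} \<le> \<epsilon>"
    by metis
  \<comment> \<open>The admissible radius varies with \<open>t\<close>; compactness reduces the
    centres to finitely many.\<close>
  obtain C where C: "finite C" "{a..b} \<subseteq> (\<Union>t\<in>C. {t - \<eta> t<..<t + \<eta> t})"
  proof (rule compactE_image[OF compact_Icc])
    show "{a..b} \<subseteq> (\<Union>t\<in>UNIV. {t - \<eta> t<..<t + \<eta> t})"
    proof
      fix s show "s \<in> (\<Union>t\<in>UNIV. {t - \<eta> t<..<t + \<eta> t})"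
        using \<eta>(1)[of s] by (intro UN_I[of s]) auto
    qed
  qed auto
  show ?thesis
  \<comment> \<open>Each centre \<open>t\<close> yields two brackets. A cut-off at or right of
    \<open>t\<close> differs from \<open>{..t}\<close> only inside the right interval, and one left
    of \<open>t\<close> differs from \<open>{..<t}\<close> only inside the left interval.\<close>
  proof (rule that[of "(\<lambda>t. ({..t}, {t<..<t + \<eta> t})) ` C \<union> (\<lambda>t. ({..<t}, {t - \<eta> t<..<t})) ` C"])
    fix s assume "s \<in> {a..b}"
    with C(2) obtain t where t: "t \<in> C" "t - \<eta> t < s" "s < t + \<eta> t" by auto
    show "\<exists>(L, D)\<in>(\<lambda>t. ({..t}, {t<..<t + \<eta> t})) ` C \<union> (\<lambda>t. ({..<t}, {t - \<eta> t<..<t})) ` C.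
        \<forall>r. (r \<le> s) \<noteq> (r \<in> L) \<longrightarrow> r \<in> D"
    proof (cases "t \<le> s")
      case True
      with t show ?thesis by (intro bexI[of _ "({..t}, {t<..<t + \<eta> t})"]) auto
    next
      case False
      with t show ?thesis by (intro bexI[of _ "({..<t}, {t - \<eta> t<..<t})"]) auto
    qed
  qed (use C(1) \<eta> in auto)
qed

text \<open>The order is coordinatewise, so one bracket is picked per coordinate. The resulting box
  can be wrong only where some coordinate is wrong, hence the error set is a union of cylinders.
  Each has marginal mass at most \<open>\<epsilon>\<close> divided by the dimension.\<close>

lemma box_brackets:
  fixes P :: "(real ^ 'd) measure"
  assumes "finite_measure P" and sets_P: "sets P = sets borel" and \<epsilon>: "0 < \<epsilon>"
  obtains F where "finite F"
    and "\<And>L D. (L, D) \<in> F \<Longrightarrow> L \<in> sets borel \<and> D \<in> sets borel \<and> measure P D \<le> \<epsilon>"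
    and "\<And>x. x \<in> cbox lo hi \<Longrightarrow> \<exists>(L, D)\<in>F. \<forall>z. (z \<le> x) \<noteq> (z \<in> L) \<longrightarrow> z \<in> D"
proof -
  interpret finite_measure P by fact
  let ?\<epsilon> = "\<epsilon> / real CARD('d)" and ?P = "\<lambda>k. distr P borel (\<lambda>z. z $ k)"
  have nth: "(\<lambda>z. z $ k) \<in> measurable P borel" for k
    using sets_P by (simp add: measurable_cong_sets[OF sets_P refl])
  define good where "good k F \<longleftrightarrow> finite F \<and>
      (\<forall>L D. (L, D) \<in> F \<longrightarrow> L \<in> sets borel \<and> D \<in> sets borel \<and> measure (?P k) D \<le> ?\<epsilon>) \<and>
      (\<forall>s\<in>{lo $ k..hi $ k}. \<exists>(L, D)\<in>F. \<forall>t. (t \<le> s) \<noteq> (t \<in> L) \<longrightarrow> t \<in> D)" for k F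
  have "\<exists>F. good k F" for k
  proof -
    have "0 < ?\<epsilon>" using \<epsilon> by simp
    then show ?thesis
    proof (rule interval_brackets[OF finite_measure_distr[OF nth, of k] sets_distr, where a = "lo $ k" and b = "hi $ k"], goal_cases)
      case (1 F)
      then show ?case unfolding good_def by (intro exI[of _ F] conjI allI impI ballI) blast+
    qed
  qed
  then obtain F where "\<And>k. good k (F k)"
    by metis
  then have F: "finite (F k)"
      "(L, D) \<in> F k \<Longrightarrow> L \<in> sets borel \<and> D \<in> sets borel \<and> measure (?P k) D \<le> ?\<epsilon>"
      "s \<in> {lo $ k..hi $ k} \<Longrightarrow> \<exists>(L, D)\<in>F k. \<forall>t. (t \<le> s) \<noteq> (t \<in> L) \<longrightarrow> t \<in> D" for k L D s
    unfolding good_def by blast+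
  define B where "B h = ({z. \<forall>k. z $ k \<in> fst (h k)}, {z. \<exists>k. z $ k \<in> snd (h k)})"
    for h :: "'d \<Rightarrow> real set \<times> real set"
  show ?thesis
  proof (rule that[of "B ` (Pi\<^sub>E UNIV F)"])
    show "finite (B ` (Pi\<^sub>E UNIV F))"
      by (intro finite_imageI finite_PiE F) simp
  next
    fix L D assume "(L, D) \<in> B ` (Pi\<^sub>E UNIV F)"
    then obtain h where h: "\<And>k. h k \<in> F k" and LD: "L = {z. \<forall>k. z $ k \<in> fst (h k)}" "D = {z. \<exists>k. z $ k \<in> snd (h k)}"
      by (auto simp: B_def)
    have hk: "fst (h k) \<in> sets borel" "snd (h k) \<in> sets borel" "measure (?P k) (snd (h k)) \<le> ?\<epsilon>" for k
      using F(2)[of "fst (h k)" "snd (h k)" k] h by auto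
    have sets: "{z. z $ k \<in> A} \<in> sets borel" if "A \<in> sets borel" for k :: 'd and A :: "real set"
      using measurable_sets[OF _ that, of "\<lambda>z. z $ k" borel] by (simp add: vimage_def)
    have "L = (\<Inter>k. {z. z $ k \<in> fst (h k)})" and D: "D = (\<Union>k. {z. z $ k \<in> snd (h k)})"
      using LD by auto
    then have "L \<in> sets borel" "D \<in> sets borel"
      using hk sets by auto
    moreover have "measure P D \<le> (\<Sum>k\<in>UNIV. measure P {z. z $ k \<in> snd (h k)})"
      unfolding D by (rule finite_measure_subadditive_finite) (use sets hk sets_P in auto)
    moreover have "measure P {z. z $ k \<in> snd (h k)} = measure (?P k) (snd (h k))" for k
      using hk sets_eq_imp_space_eq[OF sets_P] by (subst measure_distr[OF nth]) (auto simp: vimage_def)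
    moreover have "(\<Sum>k\<in>UNIV. measure (?P k) (snd (h k))) \<le> (\<Sum>k\<in>(UNIV :: 'd set). ?\<epsilon>)"
      by (intro sum_mono hk)
    ultimately show "L \<in> sets borel \<and> D \<in> sets borel \<and> measure P D \<le> \<epsilon>"
      by simp
  next
    fix x :: "real ^ 'd" assume "x \<in> cbox lo hi"
    then have "x $ k \<in> {lo $ k..hi $ k}" for k
      by (simp add: mem_box_cart)
    then have "\<forall>k. \<exists>q\<in>F k. \<forall>t. (t \<le> x $ k) \<noteq> (t \<in> fst q) \<longrightarrow> t \<in> snd q"
      using F(3) by (simp add: case_prod_unfold)
    then obtain h where h: "\<And>k. h k \<in> F k" "\<And>k t. (t \<le> x $ k) \<noteq> (t \<in> fst (h k)) \<Longrightarrow> t \<in> snd (h k)"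
      by metis
    have "\<forall>z. (z \<le> x) \<noteq> (z \<in> fst (B h)) \<longrightarrow> z \<in> snd (B h)"
      using h(2) by (auto simp: B_def less_eq_vec_def)
    moreover have "B h \<in> B ` (Pi\<^sub>E UNIV F)"
      using h(1) by auto
    ultimately show "\<exists>(L, D)\<in>B ` (Pi\<^sub>E UNIV F). \<forall>z. (z \<le> x) \<noteq> (z \<in> L) \<longrightarrow> z \<in> D"
      by (intro bexI[of _ "B h"]) (simp add: case_prod_unfold)
  qed
qed

lemma norm_integral_le:
  fixes f :: "'a \<Rightarrow> 'b::{banach, second_countable_topology}"
  assumes "integrable M f" "integrable M g" "\<And>x. x \<in> space M \<Longrightarrow> norm (f x) \<le> g x"
  shows "norm (\<integral>x. f x \<partial>M) \<le> (\<integral>x. g x \<partial>M)"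
  by (rule order_trans[OF integral_norm_bound integral_mono]) (use assms in auto)

lemma continuous_on_outer: "continuous_on UNIV (outer :: real ^ 'd \<Rightarrow> _)"
  unfolding outer_def[abs_def] by (intro continuous_intros)

lemma fst_borel: "fst \<in> borel_measurable (borel :: (real \<times> (real ^ 'd)) measure)"
  and snd_borel: "snd \<in> borel_measurable (borel :: (real \<times> (real ^ 'd)) measure)"
  by (intro borel_measurable_continuous_onI continuous_intros)+

text \<open>The fourth moment is square integrability of y^2, as the law of large numbers demands.
  The support condition holds at every sample point, so bounds on the box can be used
  pointwise.\<close>

locale dyadic_regression = dyadic_sample M NU NV U V \<tau>
  for M :: "'w measure" and NU :: "'u measure" and NV :: "'v measure" and U V
    and \<tau> :: "'u \<times> 'u \<times> 'v \<Rightarrow> real \<times> (real ^ 'd)" +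
  fixes lo hi :: "real ^ 'd"
  assumes support: "1 \<le> i \<Longrightarrow> i < j \<Longrightarrow> \<omega> \<in> space M \<Longrightarrow> snd (Z \<omega> i j) \<in> cbox lo hi"
    and fourth_moment: "integrable M (\<lambda>\<omega>. fst (Z \<omega> 1 2) ^ 4)"
begin

definition Z12 :: "'w \<Rightarrow> real \<times> (real ^ 'd)" where "Z12 \<omega> = Z \<omega> 1 2"

lemma Z12_measurable: "Z12 \<in> borel_measurable M"
  unfolding Z12_def[abs_def] by (rule Z_measurable) auto

lemma support12: "\<omega> \<in> space M \<Longrightarrow> snd (Z12 \<omega>) \<in> cbox lo hi"
  unfolding Z12_def by (rule support) auto

lemma integrable_regressor:
  fixes h :: "real ^ 'd \<Rightarrow> 'b::{banach, second_countable_topology}"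
  assumes h: "h \<in> borel_measurable borel" and bounded: "bounded (h ` cbox lo hi)"
  shows "integrable M (\<lambda>\<omega>. h (snd (Z12 \<omega>)))"
proof -
  have meas: "(\<lambda>\<omega>. h (snd (Z12 \<omega>))) \<in> borel_measurable M"
    by (rule measurable_compose[OF measurable_compose[OF Z12_measurable snd_borel] h])
  obtain C where C: "\<And>x. x \<in> cbox lo hi \<Longrightarrow> norm (h x) \<le> C"
    using bounded by (auto simp: bounded_iff)
  show ?thesis
    by (rule integrable_const_bound[where B = C]) (auto intro!: AE_I2 C support12 meas)
qed

lemma law_of_large_numbers_regressor:
  fixes h :: "real ^ 'd \<Rightarrow> 'b::euclidean_space"
  assumes h[measurable]: "h \<in> borel_measurable borel" and bounded: "bounded (h ` cbox lo hi)" and \<theta>: "0 < \<theta>"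
  shows "with_high_probability M
    (\<lambda>n \<omega>. norm (dyad_mean n (Z \<omega>) (\<lambda>z. h (snd z)) - (\<integral>\<omega>. h (snd (Z12 \<omega>)) \<partial>M)) < \<theta>)"
proof (rule law_of_large_numbers[folded Z12_def, OF _ _ \<theta>])
  show "(\<lambda>z :: real \<times> (real ^ 'd). h (snd z)) \<in> borel_measurable borel"
    by (rule measurable_compose[OF snd_borel h])
  obtain C where C: "\<And>x. x \<in> cbox lo hi \<Longrightarrow> norm (h x) \<le> C"
    using bounded by (auto simp: bounded_iff)
  show "integrable M (\<lambda>\<omega>. (norm (h (snd (Z12 \<omega>))))\<^sup>2)"
  proof (rule integrable_regressor)
    show "bounded ((\<lambda>x. (norm (h x))\<^sup>2) ` cbox lo hi)"
      using C by (auto simp: bounded_iff intro!: exI[of _ "C\<^sup>2"] power_mono)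
  qed measurable
qed

text \<open>A Glivenko-Cantelli argument: only finitely many averages, those of the bracket sets
  \<open>L\<close> and \<open>D\<close>, have to converge. Exchanging an orthant for
  \<open>L\<close> costs at most \<open>K\<close> times the frequency or the probability of
  \<open>D\<close>.\<close>

lemma uniform_law_of_large_numbers:
  assumes \<theta>: "0 < \<theta>"
  shows "with_high_probability M
    (\<lambda>n \<omega>. \<forall>x\<in>cbox lo hi. norm (sample_M n (Z \<omega>) x - pop_M M Z12 x) \<le> \<theta>)"
proof -
  obtain K where K: "1 \<le> K" "\<And>x. x \<in> cbox lo hi \<Longrightarrow> norm x \<le> K"
    using bounded_cbox[of lo hi] unfolding bounded_iff by (metis linear order_trans)
  \<comment> \<open>Budget: \<open>2 * K * \<epsilon>\<close> for leaving the orthant in the sample,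
    \<open>\<epsilon>\<close> for the law of large numbers on \<open>L\<close>,
    \<open>K * \<epsilon>\<close> for returning in the population. \<open>K\<close> is taken at
    least 1 so that the sum is at most \<open>4 * K * \<epsilon>\<close>.\<close>
  define \<epsilon> where "\<epsilon> = \<theta> / (4 * K)"
  have \<epsilon>: "\<epsilon> > 0" using \<theta> K by (simp add: \<epsilon>_def)
  have X_meas: "(\<lambda>\<omega>. snd (Z12 \<omega>)) \<in> borel_measurable M"
    by (rule measurable_compose[OF Z12_measurable snd_borel])
  obtain F where finF: "finite F"
    and F: "\<And>L D. (L, D) \<in> F \<Longrightarrow> L \<in> sets borel \<and> D \<in> sets borel \<and> measure (distr M borel (\<lambda>\<omega>. snd (Z12 \<omega>))) D \<le> \<epsilon>"
    and bracket: "\<And>x. x \<in> cbox lo hi \<Longrightarrow> \<exists>(L, D)\<in>F. \<forall>z. (z \<le> x) \<noteq> (z \<in> L) \<longrightarrow> z \<in> D"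
    using box_brackets[OF finite_measure_distr[OF X_meas] sets_distr \<epsilon>, of lo hi] by blast
  define X\<^sub>L where "X\<^sub>L L x = of_bool (x \<in> L) *\<^sub>R x" for L and x :: "real ^ 'd"
  define I\<^sub>D :: "(real ^ 'd) set \<Rightarrow> real ^ 'd \<Rightarrow> real" where "I\<^sub>D D x = of_bool (x \<in> D)" for D x
  have meas: "X\<^sub>L A \<in> borel_measurable borel" "I\<^sub>D A \<in> borel_measurable borel" if "A \<in> sets borel" for A
    using that unfolding X\<^sub>L_def[abs_def] I\<^sub>D_def[abs_def] by measurable
  have bdd: "bounded (X\<^sub>L A ` cbox lo hi)" "bounded (I\<^sub>D A ` cbox lo hi)" for A
    using K by (auto simp: bounded_iff X\<^sub>L_def I\<^sub>D_def intro!: exI[of _ K])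
  have I\<^sub>D_le: "(\<integral>\<omega>. I\<^sub>D D (snd (Z12 \<omega>)) \<partial>M) \<le> \<epsilon>" if "(L, D) \<in> F" for L D
  proof -
    have "(\<integral>\<omega>. I\<^sub>D D (snd (Z12 \<omega>)) \<partial>M) = integral\<^sup>L (distr M borel (\<lambda>\<omega>. snd (Z12 \<omega>))) (indicator D)"
      using F[OF that] X_meas by (subst integral_distr) (auto simp: I\<^sub>D_def indicator_def)
    then show ?thesis using F[OF that] by simp
  qed
  have "with_high_probability M (\<lambda>n \<omega>. \<forall>q\<in>F.
      norm (dyad_mean n (Z \<omega>) (\<lambda>z. X\<^sub>L (fst q) (snd z)) - (\<integral>\<omega>. X\<^sub>L (fst q) (snd (Z12 \<omega>)) \<partial>M)) < \<epsilon> \<and>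
      norm (dyad_mean n (Z \<omega>) (\<lambda>z. I\<^sub>D (snd q) (snd z)) - (\<integral>\<omega>. I\<^sub>D (snd q) (snd (Z12 \<omega>)) \<partial>M)) < \<epsilon>)"
    by (intro with_high_probability_ball with_high_probability_conj law_of_large_numbers_regressor
        meas bdd finF \<epsilon> finite_measure_axioms) (use F in auto)
  then show ?thesis
  proof (rule with_high_probability_mono, intro always_eventually allI ballI impI)
    fix n \<omega> x
    assume \<omega>: "\<omega> \<in> space M" and x: "x \<in> cbox lo hi"
      and close: "\<forall>q\<in>F.
        norm (dyad_mean n (Z \<omega>) (\<lambda>z. X\<^sub>L (fst q) (snd z)) - (\<integral>\<omega>. X\<^sub>L (fst q) (snd (Z12 \<omega>)) \<partial>M)) < \<epsilon> \<and>
        norm (dyad_mean n (Z \<omega>) (\<lambda>z. I\<^sub>D (snd q) (snd z)) - (\<integral>\<omega>. I\<^sub>D (snd q) (snd (Z12 \<omega>)) \<partial>M)) < \<epsilon>"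
    from bracket[OF x] obtain L D where LD: "(L, D) \<in> F" and br: "\<And>z. (z \<le> x) \<noteq> (z \<in> L) \<Longrightarrow> z \<in> D"
      by blast
    have closeL: "norm (dyad_mean n (Z \<omega>) (\<lambda>z. X\<^sub>L L (snd z)) - (\<integral>\<omega>. X\<^sub>L L (snd (Z12 \<omega>)) \<partial>M)) < \<epsilon>"
      and closeD: "\<bar>dyad_mean n (Z \<omega>) (\<lambda>z. I\<^sub>D D (snd z)) - (\<integral>\<omega>. I\<^sub>D D (snd (Z12 \<omega>)) \<partial>M)\<bar> < \<epsilon>"
      using bspec[OF close LD] by simp_all
    \<comment> \<open>Where orthant and bracket disagree, one term is 0 and the other is
      \<open>z\<close>.\<close>
    have diff: "norm (X\<^sub>L {..x} z - X\<^sub>L L z) \<le> K * I\<^sub>D D z" if "z \<in> cbox lo hi" for z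
      using K(1) K(2)[OF that] br[of z] by (auto simp: X\<^sub>L_def I\<^sub>D_def)
    have M: "sample_M n (Z \<omega>) x = dyad_mean n (Z \<omega>) (\<lambda>z. X\<^sub>L {..x} (snd z))"
      "pop_M M Z12 x = (\<integral>\<omega>. X\<^sub>L {..x} (snd (Z12 \<omega>)) \<partial>M)"
      by (simp_all add: sample_M_def pop_M_def X\<^sub>L_def case_prod_unfold)
    have "norm (sample_M n (Z \<omega>) x - dyad_mean n (Z \<omega>) (\<lambda>z. X\<^sub>L L (snd z)))
        \<le> dyad_mean n (Z \<omega>) (\<lambda>z. K * I\<^sub>D D (snd z))"
      unfolding M by (rule norm_dyad_mean_diff_le) (intro diff support \<omega>)
    also have "\<dots> = K * dyad_mean n (Z \<omega>) (\<lambda>z. I\<^sub>D D (snd z))"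
      by (rule dyad_mean_mult)
    \<comment> \<open>One \<open>\<epsilon>\<close> bounds the probability of \<open>D\<close>, the
      other the deviation of its frequency.\<close>
    also have "\<dots> \<le> K * (2 * \<epsilon>)"
      using closeD I\<^sub>D_le[OF LD] K(1) by (intro mult_left_mono) auto
    finally have 1: "norm (sample_M n (Z \<omega>) x - dyad_mean n (Z \<omega>) (\<lambda>z. X\<^sub>L L (snd z))) \<le> 2 * K * \<epsilon>"
      by simp
    have int: "integrable M (\<lambda>\<omega>. X\<^sub>L {..x} (snd (Z12 \<omega>)))" "integrable M (\<lambda>\<omega>. X\<^sub>L L (snd (Z12 \<omega>)))"
      "integrable M (\<lambda>\<omega>. I\<^sub>D D (snd (Z12 \<omega>)))"
      using F[OF LD] by (auto intro!: integrable_regressor meas bdd)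
    have "norm (pop_M M Z12 x - (\<integral>\<omega>. X\<^sub>L L (snd (Z12 \<omega>)) \<partial>M)) =
        norm (\<integral>\<omega>. X\<^sub>L {..x} (snd (Z12 \<omega>)) - X\<^sub>L L (snd (Z12 \<omega>)) \<partial>M)"
      unfolding M using int by simp
    also have "\<dots> \<le> (\<integral>\<omega>. K * I\<^sub>D D (snd (Z12 \<omega>)) \<partial>M)"
      by (rule norm_integral_le) (use int in \<open>auto intro!: diff support12\<close>)
    also have "\<dots> \<le> K * \<epsilon>"
      using I\<^sub>D_le[OF LD] K(1) by simp
    finally have 2: "norm (pop_M M Z12 x - (\<integral>\<omega>. X\<^sub>L L (snd (Z12 \<omega>)) \<partial>M)) \<le> K * \<epsilon>" .
    have 3: "norm (u - v) \<le> norm (u - u') + norm (u' - v') + norm (v - v')" for u v u' v' :: "real ^ 'd"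
      using norm_triangle_ineq[of "u - u'" "u' - v'"] norm_triangle_ineq[of "u - v'" "v' - v"]
        norm_minus_commute[of v v'] by simp
    have "norm (sample_M n (Z \<omega>) x - pop_M M Z12 x) \<le> 2 * K * \<epsilon> + \<epsilon> + K * \<epsilon>"
      using 3[of "sample_M n (Z \<omega>) x" "pop_M M Z12 x" "dyad_mean n (Z \<omega>) (\<lambda>z. X\<^sub>L L (snd z))"
          "\<integral>\<omega>. X\<^sub>L L (snd (Z12 \<omega>)) \<partial>M"] 1 2 closeL by linarith
    also have "\<dots> \<le> 4 * K * \<epsilon>"
      using K(1) \<epsilon> by simp
    also have "\<dots> = \<theta>"
      using K(1) by (simp add: \<epsilon>_def)
    finally show "norm (sample_M n (Z \<omega>) x - pop_M M Z12 x) \<le> \<theta>" .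
  qed
qed

end

section \<open>Node deviations\<close>

context dyadic_regression
begin

abbreviation "Q \<equiv> pop_Q M Z12"

abbreviation "\<beta> \<equiv> pop_beta M Z12"

lemma integrable_outer: "integrable M (\<lambda>\<omega>. outer (snd (Z12 \<omega>)))"
  and bounded_outer: "bounded ((outer :: real ^ 'd \<Rightarrow> _) ` cbox lo hi)"
proof -
  show b: "bounded ((outer :: real ^ 'd \<Rightarrow> _) ` cbox lo hi)"
    by (intro compact_imp_bounded compact_continuous_image continuous_on_subset[OF continuous_on_outer]) auto
  show "integrable M (\<lambda>\<omega>. outer (snd (Z12 \<omega>)))"
    by (intro integrable_regressor b borel_measurable_continuous_onI continuous_on_outer)
qed

lemma pop_Q_sym: "Q $ i $ j = Q $ j $ i"
proof -
  have "Q $ i $ j = (\<integral>\<omega>. outer (snd (Z12 \<omega>)) $ i $ j \<partial>M)" for i j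
    unfolding pop_Q_def
    using integral_bounded_linear[OF bounded_linear_compose[OF bounded_linear_vec_nth bounded_linear_vec_nth] integrable_outer]
    by simp
  then show ?thesis by (simp add: outer_def mult.commute)
qed

text \<open>This moves the inverse of \<open>Q\<close> from \<open>z\<close> to \<open>pop_M\<close>
  in \<open>r_fun\<close>, so that the population coefficient solves a linear system of the same
  kind as its estimate.\<close>

lemma pop_Q_self_adjoint: "(Q *v v) \<bullet> w = v \<bullet> (Q *v w)"
proof -
  have "transpose Q = Q"
    by (simp add: transpose_def vec_eq_iff pop_Q_sym)
  then show ?thesis
    by (metis dot_lmul_matrix vector_transpose_matrix)
qed

text \<open>Randomness is confined to four conditions: closeness of \<open>sample_Q\<close>, of
  \<open>sample_XY\<close>, of \<open>sample_M\<close> uniformly on the box, and of the mean of y^2.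
  Under them the argument is deterministic; in particular \<open>sample_Q\<close> is invertible, so
  the formulas for the estimators apply.\<close>

lemma node_deviation_small:
  fixes c :: real
  assumes c: "c > 0" and eigenvalues: "\<And>k. eigenvalue Q k \<Longrightarrow> c \<le> k"
    and beta_hat: "\<And>n \<omega>. \<omega> \<in> space M \<Longrightarrow> invertible (sample_Q n (Z \<omega>)) \<Longrightarrow>
          \<beta>hat n \<omega> = matrix_inv (sample_Q n (Z \<omega>)) *v sample_XY n (Z \<omega>)"
    and A_hat: "\<And>n \<omega> x. \<omega> \<in> space M \<Longrightarrow> invertible (sample_Q n (Z \<omega>)) \<Longrightarrow>
          A n \<omega> x = matrix_inv (sample_Q n (Z \<omega>)) *v sample_M n (Z \<omega>) x"
  shows "small_o_p_one M (\<lambda>n \<omega>. SUP x\<in>cbox lo hi. ereal (node_deviation n (Z \<omega>)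
           (d_fun M Z12 x (A n \<omega> x) (\<beta>hat n \<omega>))))"
proof (rule small_o_p_oneI[OF finite_measure_axioms])
  fix \<epsilon> :: real assume \<epsilon>: "\<epsilon> > 0"
  obtain K where K: "1 \<le> K" "\<And>x. x \<in> cbox lo hi \<Longrightarrow> norm x \<le> K"
    using bounded_cbox[of lo hi] unfolding bounded_iff by (metis linear order_trans)
  \<comment> \<open>Over an empty box the supremum would be \<open>-\<infinity>\<close>, with
    infinite absolute value.\<close>
  have box_nonempty: "cbox lo hi \<noteq> {}"
    using support12 not_empty by blast
  \<comment> \<open>A kernel vector would be an eigenvector for 0, which lies below
    \<open>c\<close>. Injectivity then provides \<open>\<kappa>\<close>.\<close>
  have "inj ((*v) Q)"
  proof (rule ccontr)
    assume "\<not> inj ((*v) Q)"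
    then obtain v where "v \<noteq> 0" "Q *v v = 0"
      unfolding matrix_left_invertible_injective[symmetric] matrix_left_invertible_ker by blast
    then have "eigenvalue Q 0" by (auto simp: eigenvalue_def)
    with eigenvalues c show False by fastforce
  qed
  then obtain \<kappa> where \<kappa>: "0 < \<kappa>" "\<And>v. \<kappa> * norm v \<le> norm (Q *v v)"
    using linear_inj_bounded_below_pos[OF matrix_vector_mul_linear] by blast
  have inv_Q: "invertible Q"
    by (rule linear_system_perturbation(1)[OF \<kappa>]) (use \<kappa> in simp)
  define q where "q = (\<integral>\<omega>. fst (Z12 \<omega>) *\<^sub>R snd (Z12 \<omega>) \<partial>M)"
  define \<mu> where "\<mu> x = pop_M M Z12 x" for x
  define a where "a x = matrix_inv Q *v \<mu> x" for x
  have Q_beta: "Q *v \<beta> = q"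
    by (simp add: pop_beta_def q_def matrix_inv_solves[OF inv_Q])
  have Q_a: "Q *v a x = \<mu> x" for x
    by (simp add: a_def matrix_inv_solves[OF inv_Q])
  have r_a: "\<mu> x \<bullet> (matrix_inv Q *v z) = a x \<bullet> z" for x z
    unfolding Q_a[of x, symmetric] pop_Q_self_adjoint matrix_inv_solves[OF inv_Q] ..
  have norm_\<mu>: "norm (\<mu> x) \<le> K" for x
  proof -
    have "norm (\<mu> x) \<le> (\<integral>\<omega>. K \<partial>M)"
      unfolding \<mu>_def pop_M_def
    proof (rule norm_integral_le)
      show "integrable M (\<lambda>\<omega>. of_bool (snd (Z12 \<omega>) \<le> x) *\<^sub>R snd (Z12 \<omega>))"
      proof (rule integrable_regressor)
        have "{z. z \<le> x} \<in> sets borel"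
          using borel_closed[OF closed_eucl_atMost, of x] by (simp add: atMost_def)
        then show "(\<lambda>z. of_bool (z \<le> x) *\<^sub>R z) \<in> borel_measurable borel" by measurable
      qed (use K in \<open>auto simp: bounded_iff intro!: exI[of _ K]\<close>)
    qed (use K support12 in auto)
    then show ?thesis by (simp add: prob_space)
  qed
  have norm_a: "norm (a x) \<le> K / \<kappa>" for x
    using order_trans[OF \<kappa>(2)[of "a x", unfolded Q_a] norm_\<mu>] \<kappa>(1)
    by (simp add: pos_le_divide_eq mult.commute)
  \<comment> \<open>A common bound for \<open>\<beta>\<close> and all \<open>a x\<close>, so that
    one estimate serves both linear systems.\<close>
  define B where "B = norm \<beta> + K / \<kappa>"
  have B: "norm \<beta> \<le> B" "norm (a x) \<le> B" "0 \<le> B" for x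
    using norm_a[of x] K(1) \<kappa>(1) by (auto simp: B_def add_increasing)
  \<comment> \<open>The added 1 is the tolerance in the law of large numbers for y^2.\<close>
  define v where "v = (\<integral>\<omega>. (fst (Z12 \<omega>))\<^sup>2 \<partial>M) + 1"
  \<comment> \<open>Chosen so that \<open>d\<close> is at most
    \<open>\<rho> * K * (C + \<bar>y\<bar>)\<close> in absolute value when both estimation errors
    are at most \<open>\<rho>\<close>. Squaring and averaging then give the bound
    \<open>(\<rho> * S)\<^sup>2\<close>.\<close>
  define C where "C = 1 + (B + 1) * K + K * B"
  define S where "S = sqrt (2 * K\<^sup>2 * (C\<^sup>2 + v))"
  have v: "v \<ge> 1" by (simp add: v_def)
  have "0 < 2 * K\<^sup>2 * (C\<^sup>2 + v)"
    using K(1) v by (intro mult_pos_pos add_nonneg_pos) auto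
  then have S: "S > 0" "S\<^sup>2 = 2 * K\<^sup>2 * (C\<^sup>2 + v)"
    by (simp_all add: S_def)
  \<comment> \<open>The cap 1 keeps the norm of \<open>A n \<omega> x\<close> below
    \<open>B + 1\<close>.\<close>
  define \<rho> where "\<rho> = min 1 (\<epsilon> / S)"
  have \<rho>: "0 < \<rho>" "\<rho> \<le> 1" "\<rho> * S \<le> \<epsilon>"
    using \<epsilon> S(1) by (auto simp: \<rho>_def min_def field_simps)
  \<comment> \<open>The first term makes the perturbation lemma applicable, the second makes its
    error bound at most \<open>\<rho>\<close>.\<close>
  define \<theta> where "\<theta> = min (\<kappa> / 2) (\<rho> * \<kappa> / (2 * (1 + B)))"
  have \<theta>: "0 < \<theta>" "\<theta> \<le> \<kappa> / 2"
    unfolding \<theta>_def using \<rho>(1) \<kappa>(1) B(3) by (simp, intro min.cobounded1)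
  have "\<theta> \<le> \<rho> * \<kappa> / (2 * (1 + B))"
    unfolding \<theta>_def by (rule min.cobounded2)
  then have "\<theta> * (2 * (1 + B)) \<le> \<rho> * \<kappa>"
    using B(3) by (subst (asm) pos_le_divide_eq) auto
  then have \<theta>_\<rho>: "2 / \<kappa> * (\<theta> + \<theta> * B) \<le> \<rho>"
    using \<kappa>(1) by (simp add: field_simps)
  have Y_meas: "(\<lambda>\<omega>. fst (Z12 \<omega>)) \<in> borel_measurable M"
    and X_meas: "(\<lambda>\<omega>. snd (Z12 \<omega>)) \<in> borel_measurable M"
    by (rule measurable_compose[OF Z12_measurable fst_borel] measurable_compose[OF Z12_measurable snd_borel])+
  have fourth: "integrable M (\<lambda>\<omega>. ((fst (Z12 \<omega>))\<^sup>2)\<^sup>2)"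
    using fourth_moment by (simp add: Z12_def)
  have second: "integrable M (\<lambda>\<omega>. (fst (Z12 \<omega>))\<^sup>2)"
    by (rule square_integrable_imp_integrable[OF _ fourth]) (use Y_meas in measurable)
  have XY_sq: "integrable M (\<lambda>\<omega>. (norm (fst (Z12 \<omega>) *\<^sub>R snd (Z12 \<omega>)))\<^sup>2)"
  proof (rule Bochner_Integration.integrable_bound)
    show "integrable M (\<lambda>\<omega>. K\<^sup>2 * (fst (Z12 \<omega>))\<^sup>2)"
      using second by simp
    show "AE \<omega> in M. norm ((norm (fst (Z12 \<omega>) *\<^sub>R snd (Z12 \<omega>)))\<^sup>2) \<le> norm (K\<^sup>2 * (fst (Z12 \<omega>))\<^sup>2)"
    proof (rule AE_I2)
      fix \<omega> assume "\<omega> \<in> space M"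
      then have "(norm (snd (Z12 \<omega>)))\<^sup>2 \<le> K\<^sup>2"
        using K support12 by (intro power_mono) auto
      then show "norm ((norm (fst (Z12 \<omega>) *\<^sub>R snd (Z12 \<omega>)))\<^sup>2) \<le> norm (K\<^sup>2 * (fst (Z12 \<omega>))\<^sup>2)"
        by (simp add: power_mult_distrib mult.commute[of "(fst (Z12 \<omega>))\<^sup>2"] mult_right_mono)
    qed
  qed (use X_meas Y_meas in measurable)
  have whp_Q: "with_high_probability M (\<lambda>n \<omega>. norm (sample_Q n (Z \<omega>) - Q) < \<theta>)"
    using law_of_large_numbers_regressor[OF borel_measurable_continuous_onI[OF continuous_on_outer] bounded_outer \<theta>(1)]
    by (simp add: sample_Q_def pop_Q_def case_prod_unfold)
  have XY_meas: "(\<lambda>z :: real \<times> (real ^ 'd). fst z *\<^sub>R snd z) \<in> borel_measurable borel"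
    by (intro borel_measurable_scaleR fst_borel snd_borel)
  have whp_XY: "with_high_probability M (\<lambda>n \<omega>. norm (sample_XY n (Z \<omega>) - q) < \<theta>)"
    using law_of_large_numbers[folded Z12_def, OF XY_meas XY_sq \<theta>(1)]
    by (simp add: sample_XY_def q_def case_prod_unfold)
  have whp_M: "with_high_probability M (\<lambda>n \<omega>. \<forall>x\<in>cbox lo hi. norm (sample_M n (Z \<omega>) x - \<mu> x) \<le> \<theta>)"
    unfolding \<mu>_def by (rule uniform_law_of_large_numbers[OF \<theta>(1)])
  have whp_Y: "with_high_probability M (\<lambda>n \<omega>. \<bar>dyad_mean n (Z \<omega>) (\<lambda>z. (fst z)\<^sup>2) - (v - 1)\<bar> < 1)"
    using law_of_large_numbers_real[folded Z12_def, OF borel_measurable_power[OF fst_borel] fourth, of 1] by (simp add: v_def)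
  show "with_high_probability M (\<lambda>n \<omega>. \<bar>SUP x\<in>cbox lo hi. ereal (node_deviation n (Z \<omega>)
      (d_fun M Z12 x (A n \<omega> x) (\<beta>hat n \<omega>)))\<bar> \<le> ereal \<epsilon>)"
  proof (rule with_high_probability_mono)
    show "with_high_probability M (\<lambda>n \<omega>. norm (sample_Q n (Z \<omega>) - Q) < \<theta> \<and> norm (sample_XY n (Z \<omega>) - q) < \<theta> \<and>
        (\<forall>x\<in>cbox lo hi. norm (sample_M n (Z \<omega>) x - \<mu> x) \<le> \<theta>) \<and>
        \<bar>dyad_mean n (Z \<omega>) (\<lambda>z. (fst z)\<^sup>2) - (v - 1)\<bar> < 1)"
      by (intro with_high_probability_conj whp_Q whp_XY whp_M whp_Y finite_measure_axioms)
    show "\<forall>\<^sub>F n in sequentially. \<forall>\<omega>\<in>space M.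
        norm (sample_Q n (Z \<omega>) - Q) < \<theta> \<and> norm (sample_XY n (Z \<omega>) - q) < \<theta> \<and>
        (\<forall>x\<in>cbox lo hi. norm (sample_M n (Z \<omega>) x - \<mu> x) \<le> \<theta>) \<and>
        \<bar>dyad_mean n (Z \<omega>) (\<lambda>z. (fst z)\<^sup>2) - (v - 1)\<bar> < 1 \<longrightarrow>
        \<bar>SUP x\<in>cbox lo hi. ereal (node_deviation n (Z \<omega>) (d_fun M Z12 x (A n \<omega> x) (\<beta>hat n \<omega>)))\<bar> \<le> ereal \<epsilon>"
      using eventually_ge_at_top[of 2]
    proof (eventually_elim, intro ballI impI, elim conjE)
      fix n \<omega> assume n: "2 \<le> n" and \<omega>: "\<omega> \<in> space M"
        and close_Q: "norm (sample_Q n (Z \<omega>) - Q) < \<theta>" and close_XY: "norm (sample_XY n (Z \<omega>) - q) < \<theta>"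
        and close_M: "\<forall>x\<in>cbox lo hi. norm (sample_M n (Z \<omega>) x - \<mu> x) \<le> \<theta>"
        and close_Y: "\<bar>dyad_mean n (Z \<omega>) (\<lambda>z. (fst z)\<^sup>2) - (v - 1)\<bar> < 1"
      let ?Q' = "sample_Q n (Z \<omega>)"
      have Q': "norm (?Q' - Q) \<le> \<kappa> / 2"
        using close_Q \<theta>(2) by simp
      note perturb = linear_system_perturbation[OF \<kappa> Q']
      have solution: "norm (matrix_inv ?Q' *v p' - w) \<le> \<rho>"
        if "Q *v w = p" "norm (p' - p) \<le> \<theta>" "norm w \<le> B" for w p p'
      proof -
        have "norm (matrix_inv ?Q' *v p' - w) \<le> 2 / \<kappa> * (norm (p' - p) + norm (?Q' - Q) * norm w)"
          by (rule perturb(2)[OF that(1)])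
        also have "\<dots> \<le> 2 / \<kappa> * (\<theta> + \<theta> * B)"
          by (intro mult_left_mono add_mono mult_mono) (use that close_Q \<theta> \<kappa>(1) in auto)
        finally show ?thesis using \<theta>_\<rho> by linarith
      qed
      have e: "norm (\<beta>hat n \<omega> - \<beta>) \<le> \<rho>"
        unfolding beta_hat[OF \<omega> perturb(1)] by (rule solution[OF Q_beta]) (use close_XY B in auto)
      have bound: "node_deviation n (Z \<omega>) (d_fun M Z12 x (A n \<omega> x) (\<beta>hat n \<omega>)) \<le> \<epsilon>"
        if x: "x \<in> cbox lo hi" for x
      proof -
        have \<alpha>: "norm (A n \<omega> x - a x) \<le> \<rho>"
          unfolding A_hat[OF \<omega> perturb(1)] by (rule solution[OF Q_a]) (use close_M x B in auto)
        have d_le: "(d_fun M Z12 x (A n \<omega> x) (\<beta>hat n \<omega>) z)\<^sup>2 \<le> \<rho>\<^sup>2 * K\<^sup>2 * 2 * C\<^sup>2 + \<rho>\<^sup>2 * K\<^sup>2 * 2 * (fst z)\<^sup>2"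
          if z: "snd z \<in> cbox lo hi" for z
        proof -
          define y where "y = fst z"
          define w where "w = snd z"
          define i :: real where "i = of_bool (w \<le> x)"
          have w: "norm w \<le> K" using K(2) z by (simp add: w_def)
          have "d_fun M Z12 x (A n \<omega> x) (\<beta>hat n \<omega>) z =
              (y - w \<bullet> \<beta>hat n \<omega>) * (i - A n \<omega> x \<bullet> w) - (y - w \<bullet> \<beta>) * (i - a x \<bullet> w)"
            by (simp add: d_fun_def r_fun_def case_prod_unfold y_def w_def i_def r_a[unfolded \<mu>_def])
          \<comment> \<open>Telescoping: first \<open>\<beta>\<close> is exchanged next to the
            estimated weight, then the weight next to the population residual, where the indicator
            cancels.\<close>
          also have "\<dots> = - ((w \<bullet> (\<beta>hat n \<omega> - \<beta>)) * (i - A n \<omega> x \<bullet> w) + (y - w \<bullet> \<beta>) * ((A n \<omega> x - a x) \<bullet> w))"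
            by (simp add: algebra_simps)
          finally have "\<bar>d_fun M Z12 x (A n \<omega> x) (\<beta>hat n \<omega>) z\<bar> \<le>
              \<bar>w \<bullet> (\<beta>hat n \<omega> - \<beta>)\<bar> * \<bar>i - A n \<omega> x \<bullet> w\<bar> + \<bar>y - w \<bullet> \<beta>\<bar> * \<bar>(A n \<omega> x - a x) \<bullet> w\<bar>"
            by (simp only: abs_minus_cancel abs_mult[symmetric] abs_triangle_ineq)
          also have "\<dots> \<le> (K * \<rho>) * (1 + (B + 1) * K) + (\<bar>y\<bar> + K * B) * (\<rho> * K)"
          proof (intro add_mono mult_mono)
            have cs: "\<bar>s \<bullet> t\<bar> \<le> p * r" if "norm s \<le> p" "norm t \<le> r" for s t :: "real ^ 'd" and p r
              using that by (intro order_trans[OF Cauchy_Schwarz_ineq2] mult_mono) (auto intro: order_trans[OF norm_ge_zero])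
            show "\<bar>w \<bullet> (\<beta>hat n \<omega> - \<beta>)\<bar> \<le> K * \<rho>" "\<bar>(A n \<omega> x - a x) \<bullet> w\<bar> \<le> \<rho> * K"
              by (rule cs w e \<alpha>)+
            have "norm (A n \<omega> x) \<le> B + 1"
              using norm_triangle_ineq[of "a x" "A n \<omega> x - a x"] \<alpha> \<rho>(2) B(2)[of x] by simp
            then have "\<bar>A n \<omega> x \<bullet> w\<bar> \<le> (B + 1) * K"
              by (rule cs[OF _ w])
            then show "\<bar>i - A n \<omega> x \<bullet> w\<bar> \<le> 1 + (B + 1) * K"
              by (auto simp: i_def)
            have "\<bar>w \<bullet> \<beta>\<bar> \<le> K * B"
              by (rule cs[OF w B(1)])
            then show "\<bar>y - w \<bullet> \<beta>\<bar> \<le> \<bar>y\<bar> + K * B" by linarith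
          qed (use K(1) \<rho>(1) B(3) in auto)
          also have "\<dots> = \<rho> * K * (C + \<bar>y\<bar>)"
            by (simp add: C_def algebra_simps)
          finally have "\<bar>d_fun M Z12 x (A n \<omega> x) (\<beta>hat n \<omega>) z\<bar>\<^sup>2 \<le> (\<rho> * K * (C + \<bar>y\<bar>))\<^sup>2"
            by (rule power_mono) simp
          also have "\<dots> \<le> (\<rho> * K)\<^sup>2 * (2 * C\<^sup>2 + 2 * y\<^sup>2)"
            unfolding power_mult_distrib[of "\<rho> * K"]
            using sum_squares_bound[of C "\<bar>y\<bar>"] by (intro mult_left_mono) (auto simp: power2_sum)
          finally show ?thesis
            by (simp add: y_def power_mult_distrib algebra_simps)
        qed
        have "dyad_mean n (Z \<omega>) (\<lambda>z. (d_fun M Z12 x (A n \<omega> x) (\<beta>hat n \<omega>) z)\<^sup>2)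
            \<le> dyad_mean n (Z \<omega>) (\<lambda>z. \<rho>\<^sup>2 * K\<^sup>2 * 2 * C\<^sup>2 + \<rho>\<^sup>2 * K\<^sup>2 * 2 * (fst z)\<^sup>2)"
          by (intro dyad_mean_mono d_le support \<omega>)
        also have "\<dots> = \<rho>\<^sup>2 * K\<^sup>2 * 2 * C\<^sup>2 + \<rho>\<^sup>2 * K\<^sup>2 * 2 * dyad_mean n (Z \<omega>) (\<lambda>z. (fst z)\<^sup>2)"
          unfolding dyad_mean_add dyad_mean_mult dyad_mean_const[OF n] ..
        also have "\<dots> \<le> \<rho>\<^sup>2 * K\<^sup>2 * 2 * C\<^sup>2 + \<rho>\<^sup>2 * K\<^sup>2 * 2 * v"
          by (intro add_left_mono mult_left_mono) (use close_Y in auto)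
        also have "\<dots> = (\<rho> * S)\<^sup>2"
          unfolding power_mult_distrib S(2) by (simp add: algebra_simps)
        finally have "sqrt (dyad_mean n (Z \<omega>) (\<lambda>z. (d_fun M Z12 x (A n \<omega> x) (\<beta>hat n \<omega>) z)\<^sup>2)) \<le> \<rho> * S"
          using \<rho>(1) S(1) by (intro real_le_lsqrt) auto
        with node_deviation_le[OF Z_sym n] \<rho>(3) show ?thesis
          by (meson order_trans)
      qed
      \<comment> \<open>The absolute value also needs a lower bound, which a single point of the box
        supplies.\<close>
      obtain x where x: "x \<in> cbox lo hi" using box_nonempty by blast
      let ?T = "\<lambda>x. ereal (node_deviation n (Z \<omega>) (d_fun M Z12 x (A n \<omega> x) (\<beta>hat n \<omega>)))"
      have "0 \<le> ?T x"
        using n by (simp add: node_deviation_def sum_nonneg)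
      also have "?T x \<le> (SUP x\<in>cbox lo hi. ?T x)"
        by (rule SUP_upper[OF x])
      finally have "0 \<le> (SUP x\<in>cbox lo hi. ?T x)" .
      moreover have "(SUP x\<in>cbox lo hi. ?T x) \<le> ereal \<epsilon>"
        by (rule SUP_least) (simp add: bound)
      ultimately show "\<bar>SUP x\<in>cbox lo hi. ?T x\<bar> \<le> ereal \<epsilon>"
        by simp
    qed
  qed
qed

end

section \<open>Reduction to the regression locale\<close>

theorem lemma14:
  fixes M :: "'w measure" and NU :: "'u measure" and NV :: "'v measure"
    and U :: "nat \<Rightarrow> 'w \<Rightarrow> 'u" and V :: "nat \<Rightarrow> nat \<Rightarrow> 'w \<Rightarrow> 'v"
    and \<tau> :: "'u \<times> 'u \<times> 'v \<Rightarrow> real \<times> (real ^ 'd)"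
    and \<X> :: "(real ^ 'd) set" and lo hi :: "real ^ 'd"
    and Z :: "'w \<Rightarrow> nat \<Rightarrow> nat \<Rightarrow> real \<times> (real ^ 'd)"
    and C\<^sub>X \<delta> c :: real
    and \<beta>hat :: "nat \<Rightarrow> 'w \<Rightarrow> real ^ 'd" and A :: "nat \<Rightarrow> 'w \<Rightarrow> real ^ 'd \<Rightarrow> real ^ 'd"
  defines "Z \<equiv> dyad_obs \<tau> U V"
  assumes sampling: "dyadic_sampling M NU NV U V"
    and tau_measurable: "\<tau> \<in> measurable (NU \<Otimes>\<^sub>M NU \<Otimes>\<^sub>M NV) borel"
    and tau_symmetric: "\<And>u u' v. u \<in> space NU \<Longrightarrow> u' \<in> space NU \<Longrightarrow> v \<in> space NV \<Longrightarrow>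
          \<tau> (u, u', v) = \<tau> (u', u, v)"
    and rectangle: "\<X> = cbox lo hi"
    and support: "\<And>i j \<omega>. 1 \<le> i \<Longrightarrow> i < j \<Longrightarrow> \<omega> \<in> space M \<Longrightarrow> snd (Z \<omega> i j) \<in> \<X>"
    and X_bounded: "AE \<omega> in M. norm (snd (Z \<omega> 1 2)) \<le> C\<^sub>X"
    and delta_pos: "\<delta> > 0"
    and Y_moment: "integrable M (\<lambda>\<omega>. \<bar>fst (Z \<omega> 1 2)\<bar> powr (4 + \<delta>))"
    and c_pos: "c > 0"
    and eigenvalues: "\<And>k. eigenvalue (pop_Q M (\<lambda>\<omega>. Z \<omega> 1 2)) k \<Longrightarrow> c \<le> k"
    and beta_hat: "\<And>n \<omega>. \<omega> \<in> space M \<Longrightarrow> invertible (sample_Q n (Z \<omega>)) \<Longrightarrow>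
          \<beta>hat n \<omega> = matrix_inv (sample_Q n (Z \<omega>)) *v sample_XY n (Z \<omega>)"
    and A_hat: "\<And>n \<omega> x. \<omega> \<in> space M \<Longrightarrow> invertible (sample_Q n (Z \<omega>)) \<Longrightarrow>
          A n \<omega> x = matrix_inv (sample_Q n (Z \<omega>)) *v sample_M n (Z \<omega>) x"
  shows "small_o_p_one M (\<lambda>n \<omega>. SUP x\<in>\<X>. ereal (node_deviation n (Z \<omega>)
           (d_fun M (\<lambda>\<omega>. Z \<omega> 1 2) x (A n \<omega> x) (\<beta>hat n \<omega>))))"
proof -
  \<comment> \<open>The smaller locale comes first: its measurability of the observations is needed
    to derive the fourth moment that the larger one assumes.\<close>
  interpret dyadic_sample M NU NV U V \<tau>
    by unfold_locales (fact sampling tau_measurable)+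
  have "integrable M (\<lambda>\<omega>. fst (Z \<omega> 1 2) ^ 4)"
  proof (rule Bochner_Integration.integrable_bound)
    show "integrable M (\<lambda>\<omega>. 1 + \<bar>fst (Z \<omega> 1 2)\<bar> powr (4 + \<delta>))"
      using Y_moment by (simp add: Z_def)
    have "(\<lambda>\<omega>. Z \<omega> 1 2) \<in> borel_measurable M"
      unfolding Z_def by (rule Z_measurable) auto
    from measurable_compose[OF this fst_borel]
    show "(\<lambda>\<omega>. fst (Z \<omega> 1 2) ^ 4) \<in> borel_measurable M"
      by (rule borel_measurable_power)
    have "y ^ 4 \<le> 1 + \<bar>y\<bar> powr (4 + \<delta>)" for y :: real
    proof (cases "\<bar>y\<bar> \<le> 1")
      case True
      then have "\<bar>y\<bar> ^ 4 \<le> 1" by (intro power_le_one) auto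
      then show ?thesis by (simp add: add_increasing2)
    next
      case False
      then have "\<bar>y\<bar> powr 4 \<le> \<bar>y\<bar> powr (4 + \<delta>)"
        using delta_pos by (intro powr_mono) auto
      with False show ?thesis by (simp add: powr_numeral)
    qed
    then show "AE \<omega> in M. norm (fst (Z \<omega> 1 2) ^ 4) \<le> norm (1 + \<bar>fst (Z \<omega> 1 2)\<bar> powr (4 + \<delta>))"
      by (auto intro!: AE_I2 simp: power_even_abs)
  qed
  then interpret dyadic_regression M NU NV U V \<tau> lo hi
    using support unfolding rectangle Z_def by unfold_locales auto
  have Z12_eq: "Z12 = (\<lambda>\<omega>. Z \<omega> 1 2)"
    by (simp add: Z12_def Z_def fun_eq_iff)
  show ?thesis
    unfolding rectangle Z_def
    by (rule node_deviation_small[unfolded Z12_eq Z_def, OF c_pos])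
      (fact eigenvalues[unfolded Z_def] beta_hat[unfolded Z_def] A_hat[unfolded Z_def])+
qed

end
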